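(* Let $\mathfrak{F}\equiv(X_i,\varphi_{ij})$ be a codiagram in $\mathfrak{Ban}$ indexed by a directed set $I$ satisfying the $\mathscr{E}$-property, with colimit $(X,\phi_i)$. Then the cocone $(\mathscr{L}(\mathfrak{F}),\psi_i)$ is a realization of the colimit of $(X_i,\varphi_{ij})$.
   Context: A directed set is a nonempty set $I$ with a reflexive and transitive relation $\le$ such that any two elements have a common upper bound. Write $i<j$ for the strict preorder induced by $\le$ ($i\le j$ and not $j\le i$). $(I,\le)$ has the $\mathscr{E}$-property if (1) for every $i\in I$ there is $j\in I$ with $i<j$; and (2) for every increasing chain $i_1<i_2<\cdots<i_n<\cdots$ in $I$ (indexed by $\mathbb{N}$) there is no $i\in I$ with $i_n\le i$ for all $n\in\mathbb{N}$. $\mathfrak{Ban}$ is the category of Banach spaces with linear isometries (not necessarily surjective) as morphisms. A codiagram indexed by $I$ is a family $(X_i,\varphi_{ij})$ of Banach spaces and linear isometries $\varphi_{ij}:X_i\to X_j$ ($i\le j$) with $\varphi_{ii}=\mathrm{id}$, $\varphi_{ik}=\varphi_{jk}\circ\varphi_{ij}$ for $i\le j\le k$. A cocone is a Banach space $Y$ with linear isometries $\psi_i:X_i\to Y$ such that $\psi_i=\psi_j\circ\varphi_{ij}$ for $i\le j$; it is a realization of the colimit if for every cocone $(Y',\rho_i)$ there is a unique linear isometry $\varphi:Y\to Y'$ with $\varphi\circ\psi_i=\rho_i$ for all $i$. A family $(x_i)_{i\in I}\in\prod_{i\in I}X_i$ is co-Cauchy if for every $\varepsilon>0$ there is $\ell\in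 I$ with $\|\varphi_{ij}(x_i)-x_j\|_{X_j}<\varepsilon$ whenever $\ell\le i\le j$. $\mathscr{L}(\mathfrak{F})$ is the vector space of co-Cauchy families modulo $(x_i)\sim(y_i)$ iff $\lim_{i\in I}\|x_i-y_i\|_{X_i}=0$ (net limit), with norm $\|(x_i)\|_{\mathscr{L}}=\lim_{i\in I}\|x_i\|_{X_i}$ (net limit, which exists). The maps $\psi_i:X_i\to\mathscr{L}(\mathfrak{F})$ send $x_i$ to the class of $(y_j)_{j\in I}$ with $y_j=\varphi_{ij}(x_i)$ if $i\le j$ and $y_j=0$ otherwise. *)

theory Defs
  imports "HOL-Analysis.Analysis" "HOL-Algebra.Algebraic_Closure_Type"
begin

section \<open>Directed sets\<close>

definition directed_preorder :: "'i set \<Rightarrow> ('i \<Rightarrow> 'i \<Rightarrow> bool) \<Rightarrow> bool" where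
  "directed_preorder I leq \<longleftrightarrow>
     I \<noteq> {} \<and> (\<forall>i\<in>I. leq i i) \<and>
     (\<forall>i\<in>I. \<forall>j\<in>I. \<forall>k\<in>I. leq i j \<longrightarrow> leq j k \<longrightarrow> leq i k) \<and>
     (\<forall>i\<in>I. \<forall>j\<in>I. \<exists>k\<in>I. leq i k \<and> leq j k)"

definition strict_part :: "('i \<Rightarrow> 'i \<Rightarrow> bool) \<Rightarrow> 'i \<Rightarrow> 'i \<Rightarrow> bool" where
  "strict_part leq i j \<longleftrightarrow> leq i j \<and> \<not> leq j i"

definition E_property :: "'i set \<Rightarrow> ('i \<Rightarrow> 'i \<Rightarrow> bool) \<Rightarrow> bool" where
  "E_property I leq \<longleftrightarrow>
     (\<forall>i\<in>I. \<exists>j\<in>I. strict_part leq i j) \<and>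
     (\<forall>c :: nat \<Rightarrow> 'i. range c \<subseteq> I \<longrightarrow> (\<forall>n. strict_part leq (c n) (c (Suc n))) \<longrightarrow>
        \<not> (\<exists>i\<in>I. \<forall>n. leq (c n) i))"

text \<open>The filter generated by the tails; convergence of the net \<open>(f i)\<close> to \<open>l\<close> is
  \<open>(f \<longlongrightarrow> l) (tail_filter I leq)\<close>.\<close>

definition tail_filter :: "'i set \<Rightarrow> ('i \<Rightarrow> 'i \<Rightarrow> bool) \<Rightarrow> 'i filter" where
  "tail_filter I leq = (INF l\<in>I. principal {i\<in>I. leq l i})"

lemma eventually_tail_filter:
  assumes "directed_preorder I leq"
  shows "eventually P (tail_filter I leq) \<longleftrightarrow> (\<exists>l\<in>I. \<forall>i\<in>I. leq l i \<longrightarrow> P i)"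
proof -
  have "eventually P (tail_filter I leq) \<longleftrightarrow> (\<exists>l\<in>I. eventually P (principal {i\<in>I. leq l i}))"
    unfolding tail_filter_def
  proof (rule eventually_INF_base)
    show "I \<noteq> {}" using assms by (simp add: directed_preorder_def)
    fix a b assume ab: "a \<in> I" "b \<in> I"
    then obtain k where k: "k \<in> I" "leq a k" "leq b k"
      using assms unfolding directed_preorder_def by blast
    have trans: "leq c i" if "c \<in> I" "i \<in> I" "leq c k" "leq k i" for c i
      using assms that k(1) unfolding directed_preorder_def by blast
    show "\<exists>x\<in>I. principal {i\<in>I. leq x i} \<le> Lattices.inf (principal {i\<in>I. leq a i}) (principal {i\<in>I. leq b i})"
    proof (rule bexI[OF _ k(1)])
      have "{i\<in>I. leq k i} \<subseteq> {i\<in>I. leq a i} \<inter> {i\<in>I. leq b i}"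
        using trans[OF ab(1) _ k(2)] trans[OF ab(2) _ k(3)] by blast
      then show "principal {i\<in>I. leq k i} \<le> Lattices.inf (principal {i\<in>I. leq a i}) (principal {i\<in>I. leq b i})"
        by (simp only: inf_principal principal_le_iff)
    qed
  qed
  then show ?thesis by (simp add: eventually_principal Ball_def imp_conjL)
qed

lemma tail_filter_neq_bot:
  assumes "directed_preorder I leq"
  shows "tail_filter I leq \<noteq> bot"
proof -
  have "\<forall>l\<in>I. leq l l" "I \<noteq> {}"
    using assms unfolding directed_preorder_def by blast+
  then have "\<not> eventually (\<lambda>_. False) (tail_filter I leq)"
    unfolding eventually_tail_filter[OF assms] by blast
  then show ?thesis by (metis eventually_bot)
qed


section \<open>Banach spaces on carrier sets\<close>

text \<open>Banach spaces have to live on carrier sets, since the members of a codiagram vary with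
  the index and the space built from the codiagram is a quotient depending on it. The
  multiplicative fields \<open>mult\<close> and \<open>one\<close>, which a record of type \<open>module\<close> inherits from
  \<open>ring\<close>, play no role. A field of class \<open>real_normed_field\<close> is isometrically \<open>\<real>\<close> or \<open>\<complex>\<close>
  by the Gelfand-Mazur theorem, so the scalar type \<open>'k\<close> covers exactly the real and the
  complex case.\<close>

record ('k, 'a) normed_module = "('k, 'a) module" +
  vnorm :: "'a \<Rightarrow> real"

locale normed_vspace = Module.module "ring_of_type_algebra" V
  for V :: "('k::real_normed_field, 'a) normed_module" (structure) +
  assumes vnorm_eq_0_iff: "x \<in> carrier V \<Longrightarrow> vnorm V x = 0 \<longleftrightarrow> x = \<zero>\<^bsub>V\<^esub>"
    and vnorm_smult: "x \<in> carrier V \<Longrightarrow> vnorm V (c \<odot>\<^bsub>V\<^esub> x) = norm c * vnorm V x"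
    and vnorm_triangle:
      "x \<in> carrier V \<Longrightarrow> y \<in> carrier V \<Longrightarrow> vnorm V (x \<oplus>\<^bsub>V\<^esub> y) \<le> vnorm V x + vnorm V y"
    and vnorm_nonneg: "x \<in> carrier V \<Longrightarrow> 0 \<le> vnorm V x"

text \<open>The locale \<open>Metric_space\<close> requires symmetry and nonnegativity also off the carrier,
  hence the case distinction.\<close>

definition vdist :: "('k::real_normed_field, 'a) normed_module \<Rightarrow> 'a \<Rightarrow> 'a \<Rightarrow> real" where
  "vdist V x y = (if x \<in> carrier V \<and> y \<in> carrier V then vnorm V (x \<ominus>\<^bsub>V\<^esub> y) else 0)"

locale banach_vspace = normed_vspace V
  for V :: "('k::real_normed_field, 'a) normed_module" (structure) +
  assumes complete: "Metric_space.mcomplete (carrier V) (vdist V)"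

lemma ring_of_type_simps:
  "carrier (ring_of_type_algebra :: 'k::field ring) = UNIV"
  "\<zero>\<^bsub>ring_of_type_algebra :: 'k ring\<^esub> = 0"
  "\<one>\<^bsub>ring_of_type_algebra :: 'k ring\<^esub> = 1"
  "c \<oplus>\<^bsub>ring_of_type_algebra :: 'k ring\<^esub> d = c + d"
  "c \<otimes>\<^bsub>ring_of_type_algebra :: 'k ring\<^esub> d = c * d"
  by (simp_all add: ring_of_type_algebra_def)

lemma (in normed_vspace) Metric_space_vdist: "Metric_space (carrier V) (vdist V)"
proof
  have neg: "vnorm V (\<ominus>\<^bsub>V\<^esub> x) = vnorm V x" if x: "x \<in> carrier V" for x
  proof -
    have closed: "(- 1) \<odot>\<^bsub>V\<^esub> x \<in> carrier V"
      using smult_closed[of "- 1" x] x by (simp only: ring_of_type_simps UNIV_I)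
    have "(- 1) \<odot>\<^bsub>V\<^esub> x \<oplus>\<^bsub>V\<^esub> x = (- 1 + 1) \<odot>\<^bsub>V\<^esub> x"
      using smult_l_distr[of "- 1" 1 x] smult_one[OF x] x
      by (simp only: ring_of_type_simps UNIV_I)
    also have "\<dots> = \<zero>\<^bsub>V\<^esub>"
      using smult_l_null[OF x] by (simp only: ring_of_type_simps add.left_inverse)
    finally have "\<ominus>\<^bsub>V\<^esub> x = (- 1) \<odot>\<^bsub>V\<^esub> x"
      by (rule M.minus_equality[OF _ x closed])
    then show ?thesis using vnorm_smult[OF x, of "- 1"] by simp
  qed
  fix x y z
  show "0 \<le> vdist V x y" by (simp add: vdist_def vnorm_nonneg)
  have "vnorm V (x \<ominus>\<^bsub>V\<^esub> y) = vnorm V (y \<ominus>\<^bsub>V\<^esub> x)" if "x \<in> carrier V" "y \<in> carrier V"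
    using neg[of "x \<ominus>\<^bsub>V\<^esub> y"] that by (simp add: M.minus_eq M.minus_add M.a_comm)
  then show "vdist V x y = vdist V y x" by (simp add: vdist_def)
  assume xy: "x \<in> carrier V" "y \<in> carrier V"
  show "vdist V x y = 0 \<longleftrightarrow> x = y"
  proof -
    have "x = y" if "x \<ominus>\<^bsub>V\<^esub> y = \<zero>\<^bsub>V\<^esub>"
      using M.minus_equality[of x "\<ominus>\<^bsub>V\<^esub> y"] that xy by (simp add: M.minus_eq)
    moreover have "x \<ominus>\<^bsub>V\<^esub> x = \<zero>\<^bsub>V\<^esub>"
      using xy by (simp add: M.minus_eq M.r_neg)
    ultimately show ?thesis
      using xy by (auto simp: vdist_def vnorm_eq_0_iff)
  qed
  assume z: "z \<in> carrier V"
  have "x \<ominus>\<^bsub>V\<^esub> z = (x \<ominus>\<^bsub>V\<^esub> y) \<oplus>\<^bsub>V\<^esub> (y \<ominus>\<^bsub>V\<^esub> z)"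
    using xy z by (simp add: M.minus_eq M.a_assoc M.r_neg1)
  then show "vdist V x z \<le> vdist V x y + vdist V y z"
    using xy z vnorm_triangle[of "x \<ominus>\<^bsub>V\<^esub> y" "y \<ominus>\<^bsub>V\<^esub> z"] by (simp add: vdist_def)
qed

definition linear_isometry ::
    "('k::real_normed_field, 'a) normed_module \<Rightarrow> ('k, 'b) normed_module \<Rightarrow> ('a \<Rightarrow> 'b) \<Rightarrow> bool" where
  "linear_isometry V W f \<longleftrightarrow>
     f \<in> carrier V \<rightarrow> carrier W \<and>
     (\<forall>x\<in>carrier V. \<forall>y\<in>carrier V. f (x \<oplus>\<^bsub>V\<^esub> y) = f x \<oplus>\<^bsub>W\<^esub> f y) \<and>
     (\<forall>c. \<forall>x\<in>carrier V. f (c \<odot>\<^bsub>V\<^esub> x) = c \<odot>\<^bsub>W\<^esub> f x) \<and>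
     (\<forall>x\<in>carrier V. vnorm W (f x) = vnorm V x)"


section \<open>Codiagrams, cocones, colimits\<close>

definition codiagram ::
    "'i set \<Rightarrow> ('i \<Rightarrow> 'i \<Rightarrow> bool) \<Rightarrow> ('i \<Rightarrow> ('k::real_normed_field, 'a) normed_module) \<Rightarrow>
     ('i \<Rightarrow> 'i \<Rightarrow> 'a \<Rightarrow> 'a) \<Rightarrow> bool" where
  "codiagram I leq F \<phi> \<longleftrightarrow>
     (\<forall>i\<in>I. banach_vspace (F i)) \<and>
     (\<forall>i\<in>I. \<forall>j\<in>I. leq i j \<longrightarrow> linear_isometry (F i) (F j) (\<phi> i j)) \<and>
     (\<forall>i\<in>I. \<forall>x\<in>carrier (F i). \<phi> i i x = x) \<and>
     (\<forall>i\<in>I. \<forall>j\<in>I. \<forall>k\<in>I. leq i j \<longrightarrow> leq j k \<longrightarrow>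
        (\<forall>x\<in>carrier (F i). \<phi> i k x = \<phi> j k (\<phi> i j x)))"

definition cocone ::
    "'i set \<Rightarrow> ('i \<Rightarrow> 'i \<Rightarrow> bool) \<Rightarrow> ('i \<Rightarrow> ('k::real_normed_field, 'a) normed_module) \<Rightarrow>
     ('i \<Rightarrow> 'i \<Rightarrow> 'a \<Rightarrow> 'a) \<Rightarrow> ('k, 'b) normed_module \<Rightarrow> ('i \<Rightarrow> 'a \<Rightarrow> 'b) \<Rightarrow> bool" where
  "cocone I leq F \<phi> Y \<psi> \<longleftrightarrow>
     banach_vspace Y \<and>
     (\<forall>i\<in>I. linear_isometry (F i) Y (\<psi> i)) \<and>
     (\<forall>i\<in>I. \<forall>j\<in>I. leq i j \<longrightarrow> (\<forall>x\<in>carrier (F i). \<psi> i x = \<psi> j (\<phi> i j x)))"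

text \<open>HOL cannot quantify over types inside a definition, so the universal property is tested
  against all cocones whose vertex has its carrier in the type \<open>'w\<close>; for arbitrary \<open>'w\<close> this
  ranges over all Banach spaces. Restricting the mediating map to be \<open>extensional\<close> makes
  equality of functions the same as equality on the carrier.\<close>

definition is_colimit ::
    "'w itself \<Rightarrow> 'i set \<Rightarrow> ('i \<Rightarrow> 'i \<Rightarrow> bool) \<Rightarrow> ('i \<Rightarrow> ('k::real_normed_field, 'a) normed_module) \<Rightarrow>
     ('i \<Rightarrow> 'i \<Rightarrow> 'a \<Rightarrow> 'a) \<Rightarrow> ('k, 'b) normed_module \<Rightarrow> ('i \<Rightarrow> 'a \<Rightarrow> 'b) \<Rightarrow> bool" where
  "is_colimit _ I leq F \<phi> Y \<psi> \<longleftrightarrow>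
     cocone I leq F \<phi> Y \<psi> \<and>
     (\<forall>(Z :: ('k, 'w) normed_module) \<rho>. cocone I leq F \<phi> Z \<rho> \<longrightarrow>
        (\<exists>!f. f \<in> extensional (carrier Y) \<and> linear_isometry Y Z f \<and>
              (\<forall>i\<in>I. \<forall>x\<in>carrier (F i). f (\<psi> i x) = \<rho> i x)))"


section \<open>The space of co-Cauchy families\<close>

definition co_cauchy ::
    "'i set \<Rightarrow> ('i \<Rightarrow> 'i \<Rightarrow> bool) \<Rightarrow> ('i \<Rightarrow> ('k::real_normed_field, 'a) normed_module) \<Rightarrow>
     ('i \<Rightarrow> 'i \<Rightarrow> 'a \<Rightarrow> 'a) \<Rightarrow> ('i \<Rightarrow> 'a) set" where
  "co_cauchy I leq F \<phi> = {x \<in> (\<Pi>\<^sub>E i\<in>I. carrier (F i)).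
     \<forall>\<epsilon>>0. \<exists>l\<in>I. \<forall>i\<in>I. \<forall>j\<in>I. leq l i \<longrightarrow> leq i j \<longrightarrow>
        vnorm (F j) (\<phi> i j (x i) \<ominus>\<^bsub>F j\<^esub> x j) < \<epsilon>}"

definition null_rel ::
    "'i set \<Rightarrow> ('i \<Rightarrow> 'i \<Rightarrow> bool) \<Rightarrow> ('i \<Rightarrow> ('k::real_normed_field, 'a) normed_module) \<Rightarrow>
     ('i \<Rightarrow> 'i \<Rightarrow> 'a \<Rightarrow> 'a) \<Rightarrow> (('i \<Rightarrow> 'a) \<times> ('i \<Rightarrow> 'a)) set" where
  "null_rel I leq F \<phi> = {(x, y). x \<in> co_cauchy I leq F \<phi> \<and> y \<in> co_cauchy I leq F \<phi> \<and>
     ((\<lambda>i. vnorm (F i) (x i \<ominus>\<^bsub>F i\<^esub> y i)) \<longlongrightarrow> 0) (tail_filter I leq)}"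

text \<open>The operations are induced from the pointwise ones; each union is over representatives
  and yields a single class.\<close>

definition L_space ::
    "'i set \<Rightarrow> ('i \<Rightarrow> 'i \<Rightarrow> bool) \<Rightarrow> ('i \<Rightarrow> ('k::real_normed_field, 'a) normed_module) \<Rightarrow>
     ('i \<Rightarrow> 'i \<Rightarrow> 'a \<Rightarrow> 'a) \<Rightarrow> ('k, ('i \<Rightarrow> 'a) set) normed_module" where
  "L_space I leq F \<phi> = \<lparr>
     carrier = co_cauchy I leq F \<phi> // null_rel I leq F \<phi>,
     monoid.mult = undefined,
     one = undefined,
     ring.zero = null_rel I leq F \<phi> `` {\<lambda>i\<in>I. \<zero>\<^bsub>F i\<^esub>},
     add = (\<lambda>A B. \<Union>x\<in>A. \<Union>y\<in>B. null_rel I leq F \<phi> `` {\<lambda>i\<in>I. x i \<oplus>\<^bsub>F i\<^esub> y i}),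
     module.smult = (\<lambda>c A. \<Union>x\<in>A. null_rel I leq F \<phi> `` {\<lambda>i\<in>I. c \<odot>\<^bsub>F i\<^esub> x i}),
     vnorm = (\<lambda>A. THE r. \<forall>x\<in>A. ((\<lambda>i. vnorm (F i) (x i)) \<longlongrightarrow> r) (tail_filter I leq)) \<rparr>"

definition L_map ::
    "'i set \<Rightarrow> ('i \<Rightarrow> 'i \<Rightarrow> bool) \<Rightarrow> ('i \<Rightarrow> ('k::real_normed_field, 'a) normed_module) \<Rightarrow>
     ('i \<Rightarrow> 'i \<Rightarrow> 'a \<Rightarrow> 'a) \<Rightarrow> 'i \<Rightarrow> 'a \<Rightarrow> ('i \<Rightarrow> 'a) set" where
  "L_map I leq F \<phi> i x =
     null_rel I leq F \<phi> `` {\<lambda>j\<in>I. if leq i j then \<phi> i j x else \<zero>\<^bsub>F j\<^esub>}"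

end

theory Submission
  imports Defs
begin

text \<open>
  Write \<open>[x]\<close> for the class of a co-Cauchy family \<open>x\<close> and \<open>\<psi>\<^sub>i\<close> for the canonical maps into
  the space \<open>L\<close> of classes. Everything rests on one observation: \<open>[x]\<close> is the limit in \<open>L\<close> of
  the net \<open>\<psi>\<^sub>i (x i)\<close> (\<open>L_map_vlim\<close>), because co-Cauchyness says precisely that
  the distance from \<open>\<psi>\<^sub>i (x i)\<close> to \<open>[x]\<close>, which is the limit over \<open>j\<close> of the norms of
  \<open>\<phi>\<^sub>i\<^sub>j (x i) - x j\<close>, becomes small.

  Given a cocone \<open>(Z, \<rho>)\<close>, a mediating isometry is continuous, so it must send \<open>[x]\<close> to the limit
  of the net \<open>\<rho>\<^sub>i (x i)\<close>; this gives uniqueness (\<open>mediating_map_vlim\<close>). Conversely that net is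
  Cauchy in the Banach space \<open>Z\<close>, since \<open>\<rho>\<^sub>i (x i) - \<rho>\<^sub>j (x j)\<close> has the norm of
  \<open>\<phi>\<^sub>i\<^sub>j (x i) - x j\<close>, and taking limits is linear, isometric, and insensitive to the choice of
  representative; this gives existence (\<open>mediating_map_exists\<close>).

  There remains the completeness of \<open>L\<close> (\<open>complete_L\<close>), and this is what the E-property provides.
  For a Cauchy sequence of classes \<open>[x\<^sub>n]\<close> one wants a diagonal family \<open>y i = x\<^bsub>\<nu> i\<^esub> i\<close> with
  \<open>\<nu> i\<close> tending to infinity along \<open>I\<close>, but so slowly that the tail of \<open>I\<close> on which
  \<open>x\<^sub>0, \<dots>, x\<^bsub>\<nu> i\<^esub>\<close> are close to each other already contains \<open>i\<close>. Pick a strictly increasing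
  chain whose \<open>n\<close>-th member starts the tail belonging to \<open>n\<close>, and let \<open>\<nu> i\<close> be the last \<open>n\<close>
  whose chain member lies below \<open>i\<close>: a last one exists because the chain has no upper bound
  (\<open>E_property_diagonal\<close>).
\<close>

section \<open>Normed spaces on carrier sets\<close>

context normed_vspace
begin

lemma scale_closed: "x \<in> carrier V \<Longrightarrow> c \<odot>\<^bsub>V\<^esub> x \<in> carrier V"
  using smult_closed[of c x] by (simp only: ring_of_type_simps UNIV_I)

lemma scale_add_left:
  "x \<in> carrier V \<Longrightarrow> (c + d) \<odot>\<^bsub>V\<^esub> x = c \<odot>\<^bsub>V\<^esub> x \<oplus>\<^bsub>V\<^esub> d \<odot>\<^bsub>V\<^esub> x"
  using smult_l_distr[of c d x] by (simp only: ring_of_type_simps UNIV_I)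

lemma scale_add_right:
  "x \<in> carrier V \<Longrightarrow> y \<in> carrier V \<Longrightarrow> c \<odot>\<^bsub>V\<^esub> (x \<oplus>\<^bsub>V\<^esub> y) = c \<odot>\<^bsub>V\<^esub> x \<oplus>\<^bsub>V\<^esub> c \<odot>\<^bsub>V\<^esub> y"
  using smult_r_distr[of c x y] by (simp only: ring_of_type_simps UNIV_I)

lemma scale_scale: "x \<in> carrier V \<Longrightarrow> (c * d) \<odot>\<^bsub>V\<^esub> x = c \<odot>\<^bsub>V\<^esub> (d \<odot>\<^bsub>V\<^esub> x)"
  using smult_assoc1[of c d x] by (simp only: ring_of_type_simps UNIV_I)

lemma scale_one: "x \<in> carrier V \<Longrightarrow> 1 \<odot>\<^bsub>V\<^esub> x = x"
  using smult_one[of x] by (simp only: ring_of_type_simps UNIV_I)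

lemma scale_zero_left: "x \<in> carrier V \<Longrightarrow> 0 \<odot>\<^bsub>V\<^esub> x = \<zero>\<^bsub>V\<^esub>"
  using smult_l_null[of x] by (simp only: ring_of_type_simps UNIV_I)

lemma scale_minus_one_add:
  assumes x: "x \<in> carrier V"
  shows "(- 1) \<odot>\<^bsub>V\<^esub> x \<oplus>\<^bsub>V\<^esub> x = \<zero>\<^bsub>V\<^esub>"
  using scale_add_left[OF x, of "- 1" 1] by (simp add: scale_one[OF x] scale_zero_left[OF x])

text \<open>Negation is multiplication by \<open>-1\<close>, so a map or a construction compatible with addition
  and scalar multiplication is compatible with differences.\<close>

lemma diff_eq_scale:
  assumes x: "x \<in> carrier V" and y: "y \<in> carrier V"
  shows "x \<ominus>\<^bsub>V\<^esub> y = x \<oplus>\<^bsub>V\<^esub> (- 1) \<odot>\<^bsub>V\<^esub> y"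
  using M.minus_equality[OF scale_minus_one_add[OF y] y scale_closed[OF y]]
  by (simp add: M.minus_eq)

lemma zero_in_carrier: "\<zero>\<^bsub>V\<^esub> \<in> carrier V"
  by simp

lemma add_closed: "x \<in> carrier V \<Longrightarrow> y \<in> carrier V \<Longrightarrow> x \<oplus>\<^bsub>V\<^esub> y \<in> carrier V"
  by simp

lemma diff_closed: "x \<in> carrier V \<Longrightarrow> y \<in> carrier V \<Longrightarrow> x \<ominus>\<^bsub>V\<^esub> y \<in> carrier V"
  by simp

lemma vnorm_zero: "vnorm V \<zero>\<^bsub>V\<^esub> = 0"
  by (simp add: vnorm_eq_0_iff)

lemma vdist_eq: "x \<in> carrier V \<Longrightarrow> y \<in> carrier V \<Longrightarrow> vdist V x y = vnorm V (x \<ominus>\<^bsub>V\<^esub> y)"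
  by (simp add: vdist_def)

lemma diff_self: "x \<in> carrier V \<Longrightarrow> x \<ominus>\<^bsub>V\<^esub> x = \<zero>\<^bsub>V\<^esub>"
  by (simp add: M.minus_eq M.r_neg)

lemma diff_zero: "x \<in> carrier V \<Longrightarrow> x \<ominus>\<^bsub>V\<^esub> \<zero>\<^bsub>V\<^esub> = x"
  by (simp add: M.minus_eq)

lemma vnorm_diff_eq_0_iff:
  assumes "x \<in> carrier V" "y \<in> carrier V"
  shows "vnorm V (x \<ominus>\<^bsub>V\<^esub> y) = 0 \<longleftrightarrow> x = y"
  using Metric_space.zero[OF Metric_space_vdist assms] by (simp add: vdist_eq assms)

lemma vnorm_diff_commute:
  assumes "x \<in> carrier V" "y \<in> carrier V"
  shows "vnorm V (x \<ominus>\<^bsub>V\<^esub> y) = vnorm V (y \<ominus>\<^bsub>V\<^esub> x)"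
  using Metric_space.commute[OF Metric_space_vdist, of x y] by (simp add: vdist_eq assms)

lemma vnorm_diff_triangle:
  assumes "x \<in> carrier V" "y \<in> carrier V" "z \<in> carrier V"
  shows "vnorm V (x \<ominus>\<^bsub>V\<^esub> z) \<le> vnorm V (x \<ominus>\<^bsub>V\<^esub> y) + vnorm V (y \<ominus>\<^bsub>V\<^esub> z)"
  using Metric_space.triangle[OF Metric_space_vdist, of x y z] by (simp add: vdist_eq assms)

lemma abs_vnorm_diff_le:
  assumes x: "x \<in> carrier V" and y: "y \<in> carrier V"
  shows "\<bar>vnorm V x - vnorm V y\<bar> \<le> vnorm V (x \<ominus>\<^bsub>V\<^esub> y)"
  using vnorm_diff_triangle[OF x y, of "\<zero>\<^bsub>V\<^esub>"] vnorm_diff_triangle[OF y x, of "\<zero>\<^bsub>V\<^esub>"]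
    vnorm_diff_commute[OF x y]
  by (simp add: diff_zero x y)

lemma add_diff_add:
  assumes "a \<in> carrier V" "b \<in> carrier V" "c \<in> carrier V" "d \<in> carrier V"
  shows "(a \<oplus>\<^bsub>V\<^esub> b) \<ominus>\<^bsub>V\<^esub> (c \<oplus>\<^bsub>V\<^esub> d) = (a \<ominus>\<^bsub>V\<^esub> c) \<oplus>\<^bsub>V\<^esub> (b \<ominus>\<^bsub>V\<^esub> d)"
  using assms by (simp add: M.minus_eq M.minus_add M.a_ac)

lemma vnorm_add_diff_add_le:
  assumes "a \<in> carrier V" "b \<in> carrier V" "c \<in> carrier V" "d \<in> carrier V"
  shows "vnorm V ((a \<oplus>\<^bsub>V\<^esub> b) \<ominus>\<^bsub>V\<^esub> (c \<oplus>\<^bsub>V\<^esub> d)) \<le> vnorm V (a \<ominus>\<^bsub>V\<^esub> c) + vnorm V (b \<ominus>\<^bsub>V\<^esub> d)"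
  using assms by (simp add: add_diff_add vnorm_triangle)

lemma vnorm_scale_diff_scale:
  assumes x: "x \<in> carrier V" and y: "y \<in> carrier V"
  shows "vnorm V (c \<odot>\<^bsub>V\<^esub> x \<ominus>\<^bsub>V\<^esub> c \<odot>\<^bsub>V\<^esub> y) = norm c * vnorm V (x \<ominus>\<^bsub>V\<^esub> y)"
proof -
  have "c \<odot>\<^bsub>V\<^esub> x \<ominus>\<^bsub>V\<^esub> c \<odot>\<^bsub>V\<^esub> y = c \<odot>\<^bsub>V\<^esub> (x \<ominus>\<^bsub>V\<^esub> y)"
    using scale_scale[OF y, of "-1" c] scale_scale[OF y, of c "-1"]
    by (simp add: diff_eq_scale x y scale_closed scale_add_right)
  then show ?thesis
    by (simp add: vnorm_smult x y)
qed

end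

lemma linear_isometryD:
  assumes "linear_isometry V W f"
  shows "x \<in> carrier V \<Longrightarrow> f x \<in> carrier W"
    and "x \<in> carrier V \<Longrightarrow> y \<in> carrier V \<Longrightarrow> f (x \<oplus>\<^bsub>V\<^esub> y) = f x \<oplus>\<^bsub>W\<^esub> f y"
    and "x \<in> carrier V \<Longrightarrow> f (c \<odot>\<^bsub>V\<^esub> x) = c \<odot>\<^bsub>W\<^esub> f x"
    and "x \<in> carrier V \<Longrightarrow> vnorm W (f x) = vnorm V x"
  using assms unfolding linear_isometry_def by blast+

lemma linear_isometry_diff:
  assumes "linear_isometry V W f" "normed_vspace V" "normed_vspace W"
    and x: "x \<in> carrier V" and y: "y \<in> carrier V"
  shows "f (x \<ominus>\<^bsub>V\<^esub> y) = f x \<ominus>\<^bsub>W\<^esub> f y"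
  using assms
  by (simp add: normed_vspace.diff_eq_scale normed_vspace.scale_closed linear_isometryD[OF assms(1)])

lemma linear_isometry_vnorm_diff:
  assumes "linear_isometry V W f" "normed_vspace V" "normed_vspace W"
    and x: "x \<in> carrier V" and y: "y \<in> carrier V"
  shows "vnorm W (f x \<ominus>\<^bsub>W\<^esub> f y) = vnorm V (x \<ominus>\<^bsub>V\<^esub> y)"
  using linear_isometry_diff[OF assms, symmetric] linear_isometryD(4)[OF assms(1)]
    normed_vspace.diff_closed[OF assms(2) x y] by simp

lemma linear_isometry_zero:
  assumes "linear_isometry V W f" "normed_vspace V" "normed_vspace W"
  shows "f \<zero>\<^bsub>V\<^esub> = \<zero>\<^bsub>W\<^esub>"
proof -
  interpret V: normed_vspace V by fact
  have z: "\<zero>\<^bsub>V\<^esub> \<in> carrier V" by simp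
  show ?thesis
    using linear_isometryD(3)[OF assms(1) z, of 0] linear_isometryD(1)[OF assms(1) z]
    by (simp add: V.scale_zero_left normed_vspace.scale_zero_left[OF assms(3)])
qed

section \<open>Convergence of nets\<close>

text \<open>A net from a directed set takes values in the carrier only for indices in the directed set, hence
  membership is required only eventually.\<close>

definition vlim :: "('k::real_normed_field, 'a) normed_module \<Rightarrow> ('i \<Rightarrow> 'a) \<Rightarrow> 'a \<Rightarrow> 'i filter \<Rightarrow> bool" where
  "vlim V s z T \<longleftrightarrow> z \<in> carrier V \<and> (\<forall>\<^sub>F i in T. s i \<in> carrier V) \<and>
     ((\<lambda>i. vnorm V (s i \<ominus>\<^bsub>V\<^esub> z)) \<longlongrightarrow> 0) T"

context normed_vspace
begin

lemma vnorm_tendsto_0_comparison: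
  assumes "(g \<longlongrightarrow> 0) T" "\<forall>\<^sub>F i in T. u i \<in> carrier V \<and> vnorm V (u i) \<le> g i"
  shows "((\<lambda>i. vnorm V (u i)) \<longlongrightarrow> 0) T"
  by (rule tendsto_sandwich[OF _ _ tendsto_const assms(1)])
    (use assms(2) in \<open>auto elim!: eventually_mono simp: vnorm_nonneg\<close>)

lemma vlim_cong:
  assumes "\<forall>\<^sub>F i in T. s i = t i"
  shows "vlim V s z T \<longleftrightarrow> vlim V t z T"
proof -
  have "(\<forall>\<^sub>F i in T. s i \<in> carrier V) \<longleftrightarrow> (\<forall>\<^sub>F i in T. t i \<in> carrier V)"
    by (rule eventually_subst) (use assms in eventually_elim, simp)
  moreover have "((\<lambda>i. vnorm V (s i \<ominus>\<^bsub>V\<^esub> z)) \<longlongrightarrow> 0) T \<longleftrightarrow> ((\<lambda>i. vnorm V (t i \<ominus>\<^bsub>V\<^esub> z)) \<longlongrightarrow> 0) T"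
    by (rule tendsto_cong) (use assms in eventually_elim, simp)
  ultimately show ?thesis
    by (simp add: vlim_def)
qed

lemma vlim_const: "z \<in> carrier V \<Longrightarrow> vlim V (\<lambda>_. z) z T"
  by (simp add: vlim_def diff_self vnorm_zero)

lemma vlim_unique:
  assumes z: "vlim V s z T" and w: "vlim V s w T" and T: "T \<noteq> bot"
  shows "z = w"
proof -
  have c: "z \<in> carrier V" "w \<in> carrier V" "\<forall>\<^sub>F i in T. s i \<in> carrier V"
    using z w by (auto simp: vlim_def)
  have "((\<lambda>i. vnorm V (s i \<ominus>\<^bsub>V\<^esub> z) + vnorm V (s i \<ominus>\<^bsub>V\<^esub> w)) \<longlongrightarrow> 0 + 0) T"
    using z w by (intro tendsto_add) (auto simp: vlim_def)
  moreover from c(3) have "\<forall>\<^sub>F i in T. z \<ominus>\<^bsub>V\<^esub> w \<in> carrier V \<and>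
      vnorm V (z \<ominus>\<^bsub>V\<^esub> w) \<le> vnorm V (s i \<ominus>\<^bsub>V\<^esub> z) + vnorm V (s i \<ominus>\<^bsub>V\<^esub> w)"
  proof eventually_elim
    case (elim i)
    then show ?case
      using vnorm_diff_triangle[of z "s i" w] vnorm_diff_commute[of z "s i"] c(1,2) by simp
  qed
  ultimately have "((\<lambda>i. vnorm V (z \<ominus>\<^bsub>V\<^esub> w)) \<longlongrightarrow> 0) T"
    by (simp add: vnorm_tendsto_0_comparison)
  then show ?thesis
    using tendsto_unique[OF T tendsto_const] vnorm_diff_eq_0_iff[OF c(1,2)] by blast
qed

lemma vlim_add:
  assumes "vlim V s z T" "vlim V t w T"
  shows "vlim V (\<lambda>i. s i \<oplus>\<^bsub>V\<^esub> t i) (z \<oplus>\<^bsub>V\<^esub> w) T"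
proof -
  have c: "z \<in> carrier V" "w \<in> carrier V" "\<forall>\<^sub>F i in T. s i \<in> carrier V \<and> t i \<in> carrier V"
    using assms by (auto simp: vlim_def eventually_conj)
  have "((\<lambda>i. vnorm V (s i \<ominus>\<^bsub>V\<^esub> z) + vnorm V (t i \<ominus>\<^bsub>V\<^esub> w)) \<longlongrightarrow> 0 + 0) T"
    using assms by (intro tendsto_add) (auto simp: vlim_def)
  moreover from c(3) have "\<forall>\<^sub>F i in T. (s i \<oplus>\<^bsub>V\<^esub> t i) \<ominus>\<^bsub>V\<^esub> (z \<oplus>\<^bsub>V\<^esub> w) \<in> carrier V \<and>
      vnorm V ((s i \<oplus>\<^bsub>V\<^esub> t i) \<ominus>\<^bsub>V\<^esub> (z \<oplus>\<^bsub>V\<^esub> w)) \<le> vnorm V (s i \<ominus>\<^bsub>V\<^esub> z) + vnorm V (t i \<ominus>\<^bsub>V\<^esub> w)"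
    by eventually_elim (simp add: c vnorm_add_diff_add_le)
  ultimately have "((\<lambda>i. vnorm V ((s i \<oplus>\<^bsub>V\<^esub> t i) \<ominus>\<^bsub>V\<^esub> (z \<oplus>\<^bsub>V\<^esub> w))) \<longlongrightarrow> 0) T"
    by (simp add: vnorm_tendsto_0_comparison)
  moreover from c(3) have "\<forall>\<^sub>F i in T. s i \<oplus>\<^bsub>V\<^esub> t i \<in> carrier V"
    by eventually_elim simp
  ultimately show ?thesis
    using c(1,2) by (simp add: vlim_def)
qed

lemma vlim_scale:
  assumes "vlim V s z T"
  shows "vlim V (\<lambda>i. c \<odot>\<^bsub>V\<^esub> s i) (c \<odot>\<^bsub>V\<^esub> z) T"
proof -
  have c: "z \<in> carrier V" "\<forall>\<^sub>F i in T. s i \<in> carrier V"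
    using assms by (auto simp: vlim_def)
  have "((\<lambda>i. norm c * vnorm V (s i \<ominus>\<^bsub>V\<^esub> z)) \<longlongrightarrow> norm c * 0) T"
    using assms by (intro tendsto_mult tendsto_const) (auto simp: vlim_def)
  moreover from c(2) have "\<forall>\<^sub>F i in T. c \<odot>\<^bsub>V\<^esub> s i \<ominus>\<^bsub>V\<^esub> c \<odot>\<^bsub>V\<^esub> z \<in> carrier V \<and>
      vnorm V (c \<odot>\<^bsub>V\<^esub> s i \<ominus>\<^bsub>V\<^esub> c \<odot>\<^bsub>V\<^esub> z) \<le> norm c * vnorm V (s i \<ominus>\<^bsub>V\<^esub> z)"
    by eventually_elim (simp add: c scale_closed vnorm_scale_diff_scale)
  ultimately have "((\<lambda>i. vnorm V (c \<odot>\<^bsub>V\<^esub> s i \<ominus>\<^bsub>V\<^esub> c \<odot>\<^bsub>V\<^esub> z)) \<longlongrightarrow> 0) T"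
    by (simp add: vnorm_tendsto_0_comparison)
  moreover from c(2) have "\<forall>\<^sub>F i in T. c \<odot>\<^bsub>V\<^esub> s i \<in> carrier V"
    by eventually_elim (rule scale_closed)
  ultimately show ?thesis
    using c(1) by (simp add: vlim_def scale_closed)
qed

lemma vlim_vnorm:
  assumes "vlim V s z T"
  shows "((\<lambda>i. vnorm V (s i)) \<longlongrightarrow> vnorm V z) T"
proof (rule LIM_zero_cancel, rule tendsto_rabs_zero_cancel)
  have c: "z \<in> carrier V" "\<forall>\<^sub>F i in T. s i \<in> carrier V" "((\<lambda>i. vnorm V (s i \<ominus>\<^bsub>V\<^esub> z)) \<longlongrightarrow> 0) T"
    using assms by (auto simp: vlim_def)
  from c(2) have "\<forall>\<^sub>F i in T. \<bar>vnorm V (s i) - vnorm V z\<bar> \<le> vnorm V (s i \<ominus>\<^bsub>V\<^esub> z)"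
    by eventually_elim (simp add: c(1) abs_vnorm_diff_le)
  then show "((\<lambda>i. \<bar>vnorm V (s i) - vnorm V z\<bar>) \<longlongrightarrow> 0) T"
    by (intro tendsto_sandwich[OF _ _ tendsto_const c(3)]) simp_all
qed

text \<open>A limit is unchanged by a perturbation that tends to zero; this makes limits along a cocone
  independent of representatives.\<close>

lemma vlim_near:
  assumes "vlim V s z T" and t: "\<forall>\<^sub>F i in T. t i \<in> carrier V"
    and "((\<lambda>i. vnorm V (s i \<ominus>\<^bsub>V\<^esub> t i)) \<longlongrightarrow> 0) T"
  shows "vlim V t z T"
proof -
  have c: "z \<in> carrier V" "\<forall>\<^sub>F i in T. s i \<in> carrier V \<and> t i \<in> carrier V"
    using assms by (auto simp: vlim_def eventually_conj)
  have "((\<lambda>i. vnorm V (s i \<ominus>\<^bsub>V\<^esub> t i) + vnorm V (s i \<ominus>\<^bsub>V\<^esub> z)) \<longlongrightarrow> 0 + 0) T"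
    using assms by (intro tendsto_add) (auto simp: vlim_def)
  moreover from c(2) have "\<forall>\<^sub>F i in T. t i \<ominus>\<^bsub>V\<^esub> z \<in> carrier V \<and>
      vnorm V (t i \<ominus>\<^bsub>V\<^esub> z) \<le> vnorm V (s i \<ominus>\<^bsub>V\<^esub> t i) + vnorm V (s i \<ominus>\<^bsub>V\<^esub> z)"
  proof eventually_elim
    case (elim i)
    then show ?case
      using vnorm_diff_triangle[of "t i" "s i" z] vnorm_diff_commute[of "t i" "s i"] c(1) by simp
  qed
  ultimately have "((\<lambda>i. vnorm V (t i \<ominus>\<^bsub>V\<^esub> z)) \<longlongrightarrow> 0) T"
    by (simp add: vnorm_tendsto_0_comparison)
  then show ?thesis
    using c(1) t by (auto simp: vlim_def)
qed

end

lemma linear_isometry_vlim: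
  assumes "linear_isometry V W f" "normed_vspace V" "normed_vspace W" "vlim V s z T"
  shows "vlim W (\<lambda>i. f (s i)) (f z) T"
proof -
  have c: "z \<in> carrier V" "\<forall>\<^sub>F i in T. s i \<in> carrier V" "((\<lambda>i. vnorm V (s i \<ominus>\<^bsub>V\<^esub> z)) \<longlongrightarrow> 0) T"
    using assms(4) by (auto simp: vlim_def)
  from c(2) have "\<forall>\<^sub>F i in T. vnorm V (s i \<ominus>\<^bsub>V\<^esub> z) = vnorm W (f (s i) \<ominus>\<^bsub>W\<^esub> f z)"
    by eventually_elim (simp add: linear_isometry_vnorm_diff[OF assms(1-3) _ c(1)])
  with c(3) have "((\<lambda>i. vnorm W (f (s i) \<ominus>\<^bsub>W\<^esub> f z)) \<longlongrightarrow> 0) T"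
    by (rule Lim_transform_eventually)
  moreover from c(2) have "\<forall>\<^sub>F i in T. f (s i) \<in> carrier W"
    by eventually_elim (rule linear_isometryD(1)[OF assms(1)])
  ultimately show ?thesis
    using c(1) by (simp add: vlim_def linear_isometryD(1)[OF assms(1)])
qed

lemma eventually_in_index_set:
  assumes "directed_preorder I leq"
  shows "\<forall>\<^sub>F i in tail_filter I leq. i \<in> I"
proof -
  obtain l where "l \<in> I"
    using assms unfolding directed_preorder_def by blast
  then show ?thesis
    unfolding eventually_tail_filter[OF assms] by blast
qed

text \<open>Sequential completeness suffices for nets: along an increasing sequence \<open>c\<close> of indices such
  that the tail above \<open>c n\<close> has diameter below \<open>1 / (n + 1)\<close> the net is a Cauchy sequence, and its
  limit attracts the whole net. The sequence \<open>c\<close> need not be cofinal.\<close>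

lemma (in Metric_space) directed_Cauchy_net_converges:
  assumes dir: "directed_preorder I leq" and compl: mcomplete
    and s: "\<And>i. i \<in> I \<Longrightarrow> s i \<in> M"
    and cauchy: "\<And>\<epsilon>. \<epsilon> > 0 \<Longrightarrow> \<exists>l\<in>I. \<forall>i\<in>I. leq l i \<longrightarrow> d (s l) (s i) < \<epsilon>"
  shows "\<exists>z. limitin mtopology s z (tail_filter I leq)"
proof -
  have trans: "leq i k" if "leq i j" "leq j k" "i \<in> I" "j \<in> I" "k \<in> I" for i j k
    using dir that unfolding directed_preorder_def by blast
  have upper: "\<exists>k\<in>I. leq i k \<and> leq j k" if "i \<in> I" "j \<in> I" for i j
    using dir that unfolding directed_preorder_def by blast
  let ?e = "\<lambda>n. inverse (real (Suc n))"
  define P where "P n l \<longleftrightarrow> l \<in> I \<and> (\<forall>i\<in>I. \<forall>j\<in>I. leq l i \<longrightarrow> leq l j \<longrightarrow> d (s i) (s j) < ?e n)" for n l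
  have ex: "\<exists>k. P n k \<and> leq l k" if l: "l \<in> I" for n l
  proof -
    have "0 < ?e n / 2"
      by simp
    from cauchy[OF this]
    obtain m where m: "m \<in> I" "\<forall>i\<in>I. leq m i \<longrightarrow> d (s m) (s i) < ?e n / 2"
      by blast
    obtain k where k: "k \<in> I" "leq l k" "leq m k"
      using upper[OF l m(1)] by blast
    have "d (s i) (s j) < ?e n" if "i \<in> I" "j \<in> I" "leq k i" "leq k j" for i j
    proof -
      have "leq m i" "leq m j"
        using trans k m(1) that by blast+
      then have "d (s m) (s i) < ?e n / 2" "d (s m) (s j) < ?e n / 2"
        using m(2) that by blast+
      then show ?thesis
        using triangle[OF s[OF that(1)] s[OF m(1)] s[OF that(2)]] commute[of "s i" "s m"]
        by linarith
    qed
    then have "P n k"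
      using k(1) unfolding P_def by blast
    then show ?thesis
      using k(2) by blast
  qed
  have "\<exists>c. \<forall>n. P n (c n) \<and> leq (c n) (c (Suc n))"
  proof (rule dependent_nat_choice[of P "\<lambda>_. leq"])
    obtain l where "l \<in> I"
      using dir unfolding directed_preorder_def by blast
    then show "\<exists>k. P 0 k"
      using ex[of l 0] by blast
    show "\<exists>k. P (Suc n) k \<and> leq l k" if "P n l" for n l
    proof -
      have "l \<in> I"
        using that unfolding P_def by blast
      then show ?thesis
        by (rule ex)
    qed
  qed
  then obtain c where c: "\<And>n. P n (c n)" "\<And>n. leq (c n) (c (Suc n))"
    by blast
  have cI: "c n \<in> I" for n
    using c(1) by (simp add: P_def)
  have mono: "leq (c n) (c m)" if "n \<le> m" for n m
    using that
  proof (induction rule: dec_induct)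
    case base
    then show ?case using dir cI unfolding directed_preorder_def by blast
  next
    case (step k)
    then show ?case using trans c(2) cI by blast
  qed
  have tail: "d (s (c n)) (s i) < ?e n" if "i \<in> I" "leq (c n) i" for n i
    using c(1)[of n] mono[OF order_refl, of n] cI[of n] that unfolding P_def by blast
  have "MCauchy (\<lambda>n. s (c n))"
    unfolding MCauchy_def
  proof (intro conjI allI impI)
    show "range (\<lambda>n. s (c n)) \<subseteq> M" using s cI by blast
    fix \<epsilon> :: real assume "\<epsilon> > 0"
    then obtain N where N: "?e N < \<epsilon>" using reals_Archimedean by blast
    have "d (s (c n)) (s (c m)) < \<epsilon>" if "N \<le> n" "N \<le> m" for n m
    proof -
      have "d (s (c n)) (s (c m)) < ?e N"
        using c(1)[of N] mono[OF that(1)] mono[OF that(2)] cI[of n] cI[of m]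
        unfolding P_def by blast
      then show ?thesis
        using N by (rule less_trans)
    qed
    then show "\<exists>N. \<forall>n n'. N \<le> n \<longrightarrow> N \<le> n' \<longrightarrow> d (s (c n)) (s (c n')) < \<epsilon>" by blast
  qed
  then obtain z where z: "limitin mtopology (\<lambda>n. s (c n)) z sequentially"
    using compl unfolding mcomplete_def by blast
  have zM: "z \<in> M" using z limitin_mspace by blast
  have "limitin mtopology s z (tail_filter I leq)"
    unfolding limitin_metric
  proof (intro conjI allI impI zM)
    fix \<epsilon> :: real assume "\<epsilon> > 0"
    then obtain N where N: "?e N < \<epsilon>/2" using reals_Archimedean[OF half_gt_zero] by blast
    obtain N' where "\<And>n. n \<ge> N' \<Longrightarrow> d (s (c n)) z < \<epsilon>/2"
      using z \<open>\<epsilon> > 0\<close> unfolding limit_metric_sequentially by (meson half_gt_zero)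
    then have lim: "d (s (c (max N N'))) z < \<epsilon>/2" by simp
    have "s i \<in> M \<and> d (s i) z < \<epsilon>" if i: "i \<in> I" "leq (c (max N N')) i" for i
    proof -
      have "?e (max N N') \<le> ?e N"
        by (intro le_imp_inverse_le) auto
      then have "d (s (c (max N N'))) (s i) < \<epsilon>/2"
        using tail[OF i] N by linarith
      then show ?thesis
        using lim triangle[OF s[OF i(1)] s[OF cI] zM, of "max N N'"]
          commute[of "s i" "s (c (max N N'))"] s[OF i(1)]
        by linarith
    qed
    then show "\<forall>\<^sub>F i in tail_filter I leq. s i \<in> M \<and> d (s i) z < \<epsilon>"
      unfolding eventually_tail_filter[OF dir] using cI by blast
  qed
  then show ?thesis by blast
qed

lemma (in banach_vspace) Cauchy_net_converges:
  assumes dir: "directed_preorder I leq" and s: "\<And>i. i \<in> I \<Longrightarrow> s i \<in> carrier V"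
    and cauchy: "\<And>\<epsilon>. \<epsilon> > 0 \<Longrightarrow> \<exists>l\<in>I. \<forall>i\<in>I. leq l i \<longrightarrow> vnorm V (s l \<ominus>\<^bsub>V\<^esub> s i) < \<epsilon>"
  shows "\<exists>z. vlim V s z (tail_filter I leq)"
proof -
  interpret D: Metric_space "carrier V" "vdist V" by (rule Metric_space_vdist)
  have "\<exists>l\<in>I. \<forall>i\<in>I. leq l i \<longrightarrow> vdist V (s l) (s i) < \<epsilon>" if "\<epsilon> > 0" for \<epsilon>
    using cauchy[OF that] by (auto simp: vdist_eq s)
  then obtain z where z: "limitin D.mtopology s z (tail_filter I leq)"
    using D.directed_Cauchy_net_converges[OF dir complete] s by blast
  have "((\<lambda>i. vnorm V (s i \<ominus>\<^bsub>V\<^esub> z)) \<longlongrightarrow> 0) (tail_filter I leq)"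
  proof (rule tendstoI)
    fix \<epsilon> :: real assume "\<epsilon> > 0"
    then have "\<forall>\<^sub>F i in tail_filter I leq. s i \<in> carrier V \<and> vdist V (s i) z < \<epsilon>" "z \<in> carrier V"
      using z by (auto simp: D.limitin_metric)
    then show "\<forall>\<^sub>F i in tail_filter I leq. dist (vnorm V (s i \<ominus>\<^bsub>V\<^esub> z)) 0 < \<epsilon>"
      by (auto elim!: eventually_mono simp: vdist_eq vnorm_nonneg)
  qed
  moreover have "\<forall>\<^sub>F i in tail_filter I leq. s i \<in> carrier V"
    using eventually_in_index_set[OF dir] by eventually_elim (rule s)
  moreover have "z \<in> carrier V"
    using z by (rule D.limitin_mspace)
  ultimately show ?thesis by (auto simp: vlim_def)
qed

lemma real_Cauchy_net_converges:
  fixes s :: "'i \<Rightarrow> real"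
  assumes dir: "directed_preorder I leq"
    and cauchy: "\<And>\<epsilon>. \<epsilon> > 0 \<Longrightarrow> \<exists>l\<in>I. \<forall>i\<in>I. leq l i \<longrightarrow> \<bar>s l - s i\<bar> < \<epsilon>"
  shows "\<exists>z. (s \<longlongrightarrow> z) (tail_filter I leq)"
proof -
  have "\<exists>z. limitin Met_TC.mtopology s z (tail_filter I leq)"
  proof (rule Met_TC.directed_Cauchy_net_converges[OF dir])
    show "Met_TC.mcomplete TYPE(real)"
      by (simp only: mcomplete_iff_complete complete_UNIV)
    show "\<exists>l\<in>I. \<forall>i\<in>I. leq l i \<longrightarrow> dist (s l) (s i) < \<epsilon>" if "\<epsilon> > 0" for \<epsilon>
      using cauchy[OF that] by (simp only: dist_real_def)
  qed (rule UNIV_I)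
  then show ?thesis
    by (simp only: mtopology_is_euclidean limitin_canonical_iff)
qed

section \<open>Co-Cauchy families and their classes\<close>

locale directed_codiagram =
  fixes I :: "'i set" and leq :: "'i \<Rightarrow> 'i \<Rightarrow> bool"
    and F :: "'i \<Rightarrow> ('k::real_normed_field, 'a) normed_module"
    and \<phi> :: "'i \<Rightarrow> 'i \<Rightarrow> 'a \<Rightarrow> 'a"
  assumes directed: "directed_preorder I leq"
    and codiagram: "codiagram I leq F \<phi>"
begin

abbreviation "T \<equiv> tail_filter I leq"
abbreviation "CC \<equiv> co_cauchy I leq F \<phi>"
abbreviation "R \<equiv> null_rel I leq F \<phi>"
abbreviation "L \<equiv> L_space I leq F \<phi>"
abbreviation "cls x \<equiv> R `` {x}"

lemma index_refl: "i \<in> I \<Longrightarrow> leq i i"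
  using directed unfolding directed_preorder_def by blast

lemma index_trans: "leq i j \<Longrightarrow> leq j k \<Longrightarrow> i \<in> I \<Longrightarrow> j \<in> I \<Longrightarrow> k \<in> I \<Longrightarrow> leq i k"
  using directed unfolding directed_preorder_def by blast

lemma index_nonempty: "I \<noteq> {}"
  using directed unfolding directed_preorder_def by blast

lemma eventually_T: "eventually P T \<longleftrightarrow> (\<exists>l\<in>I. \<forall>i\<in>I. leq l i \<longrightarrow> P i)"
  by (rule eventually_tail_filter[OF directed])

lemma T_neq_bot: "T \<noteq> bot"
  by (rule tail_filter_neq_bot[OF directed])

lemma eventually_I: "\<forall>\<^sub>F i in T. i \<in> I"
  by (rule eventually_in_index_set[OF directed])

lemma eventually_above:
  assumes "l \<in> I"
  shows "\<forall>\<^sub>F i in T. i \<in> I \<and> leq l i"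
  unfolding eventually_T using assms by blast

lemma banach: "i \<in> I \<Longrightarrow> banach_vspace (F i)"
  using codiagram unfolding codiagram_def by blast

lemma normed: "i \<in> I \<Longrightarrow> normed_vspace (F i)"
  using banach banach_vspace.axioms(1) by blast

lemma isometry: "i \<in> I \<Longrightarrow> j \<in> I \<Longrightarrow> leq i j \<Longrightarrow> linear_isometry (F i) (F j) (\<phi> i j)"
  using codiagram unfolding codiagram_def by blast

lemma \<phi>_comp:
  "i \<in> I \<Longrightarrow> j \<in> I \<Longrightarrow> k \<in> I \<Longrightarrow> leq i j \<Longrightarrow> leq j k \<Longrightarrow> a \<in> carrier (F i) \<Longrightarrow>
    \<phi> j k (\<phi> i j a) = \<phi> i k a"
  using codiagram unfolding codiagram_def by metis

lemmas \<phi>_closed = linear_isometryD(1)[OF isometry]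
  and \<phi>_add = linear_isometryD(2)[OF isometry]
  and \<phi>_scale = linear_isometryD(3)[OF isometry]
  and vnorm_\<phi> = linear_isometryD(4)[OF isometry]

lemma \<phi>_zero: "i \<in> I \<Longrightarrow> j \<in> I \<Longrightarrow> leq i j \<Longrightarrow> \<phi> i j \<zero>\<^bsub>F i\<^esub> = \<zero>\<^bsub>F j\<^esub>"
  by (rule linear_isometry_zero[OF isometry normed normed])

lemma vnorm_\<phi>_diff:
  "i \<in> I \<Longrightarrow> j \<in> I \<Longrightarrow> leq i j \<Longrightarrow> a \<in> carrier (F i) \<Longrightarrow> b \<in> carrier (F i) \<Longrightarrow>
    vnorm (F j) (\<phi> i j a \<ominus>\<^bsub>F j\<^esub> \<phi> i j b) = vnorm (F i) (a \<ominus>\<^bsub>F i\<^esub> b)"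
  by (rule linear_isometry_vnorm_diff[OF isometry normed normed])

lemmas closed =
  normed_vspace.zero_in_carrier[OF normed] normed_vspace.add_closed[OF normed]
  normed_vspace.scale_closed[OF normed] normed_vspace.diff_closed[OF normed]

lemmas vnorm_ge_0 = normed_vspace.vnorm_nonneg[OF normed]

definition fam_zero :: "'i \<Rightarrow> 'a" where
  "fam_zero = (\<lambda>i\<in>I. \<zero>\<^bsub>F i\<^esub>)"

definition fam_add :: "('i \<Rightarrow> 'a) \<Rightarrow> ('i \<Rightarrow> 'a) \<Rightarrow> 'i \<Rightarrow> 'a" where
  "fam_add x y = (\<lambda>i\<in>I. x i \<oplus>\<^bsub>F i\<^esub> y i)"

definition fam_scale :: "'k \<Rightarrow> ('i \<Rightarrow> 'a) \<Rightarrow> 'i \<Rightarrow> 'a" where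
  "fam_scale c x = (\<lambda>i\<in>I. c \<odot>\<^bsub>F i\<^esub> x i)"

text \<open>The representative that defines the canonical map at \<open>i\<close>.\<close>

definition fam_push :: "'i \<Rightarrow> 'a \<Rightarrow> 'i \<Rightarrow> 'a" where
  "fam_push i a = (\<lambda>j\<in>I. if leq i j then \<phi> i j a else \<zero>\<^bsub>F j\<^esub>)"

lemma fam_apply:
  assumes "i \<in> I"
  shows "fam_zero i = \<zero>\<^bsub>F i\<^esub>" "fam_add x y i = x i \<oplus>\<^bsub>F i\<^esub> y i"
    "fam_scale c x i = c \<odot>\<^bsub>F i\<^esub> x i"
    "fam_push j a i = (if leq j i then \<phi> j i a else \<zero>\<^bsub>F i\<^esub>)"
  using assms by (simp_all add: fam_zero_def fam_add_def fam_scale_def fam_push_def)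

text \<open>In filter form, finitely many smallness conditions combine without choosing common upper
  bounds.\<close>

lemma co_cauchy_iff:
  "x \<in> CC \<longleftrightarrow> x \<in> (\<Pi>\<^sub>E i\<in>I. carrier (F i)) \<and>
    (\<forall>\<epsilon>>0. \<forall>\<^sub>F i in T. \<forall>j\<in>I. leq i j \<longrightarrow> vnorm (F j) (\<phi> i j (x i) \<ominus>\<^bsub>F j\<^esub> x j) < \<epsilon>)"
  unfolding eventually_T co_cauchy_def by blast

lemma co_cauchyI:
  assumes "x \<in> (\<Pi>\<^sub>E i\<in>I. carrier (F i))"
    and "\<And>\<epsilon>. \<epsilon> > 0 \<Longrightarrow> \<forall>\<^sub>F i in T. \<forall>j\<in>I. leq i j \<longrightarrow> vnorm (F j) (\<phi> i j (x i) \<ominus>\<^bsub>F j\<^esub> x j) < \<epsilon>"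
  shows "x \<in> CC"
  using assms unfolding co_cauchy_iff by blast

lemma co_cauchy_small:
  assumes "x \<in> CC" "\<epsilon> > 0"
  shows "\<forall>\<^sub>F i in T. \<forall>j\<in>I. leq i j \<longrightarrow> vnorm (F j) (\<phi> i j (x i) \<ominus>\<^bsub>F j\<^esub> x j) < \<epsilon>"
  using assms unfolding co_cauchy_iff by blast

lemma co_cauchy_PiE: "x \<in> CC \<Longrightarrow> x \<in> (\<Pi>\<^sub>E i\<in>I. carrier (F i))"
  unfolding co_cauchy_iff by blast

lemma co_cauchy_mem: "x \<in> CC \<Longrightarrow> i \<in> I \<Longrightarrow> x i \<in> carrier (F i)"
  using co_cauchy_PiE by blast

lemma fam_push_co_cauchy:
  assumes i: "i \<in> I" and a: "a \<in> carrier (F i)"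
  shows "fam_push i a \<in> CC"
proof (rule co_cauchyI)
  show "fam_push i a \<in> (\<Pi>\<^sub>E j\<in>I. carrier (F j))"
    unfolding fam_push_def using i a by (simp add: \<phi>_closed closed)
  fix \<epsilon> :: real assume "\<epsilon> > 0"
  from eventually_above[OF i]
  show "\<forall>\<^sub>F j in T. \<forall>k\<in>I. leq j k \<longrightarrow>
      vnorm (F k) (\<phi> j k (fam_push i a j) \<ominus>\<^bsub>F k\<^esub> fam_push i a k) < \<epsilon>"
  proof (eventually_elim, intro ballI impI)
    fix j k assume j: "j \<in> I \<and> leq i j" and k: "k \<in> I" "leq j k"
    then have "leq i k" using index_trans i by blast
    with j k show "vnorm (F k) (\<phi> j k (fam_push i a j) \<ominus>\<^bsub>F k\<^esub> fam_push i a k) < \<epsilon>"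
      using \<open>\<epsilon> > 0\<close> i a
      by (simp add: fam_apply \<phi>_comp \<phi>_closed normed_vspace.diff_self[OF normed]
        normed_vspace.vnorm_zero[OF normed])
  qed
qed

lemma fam_zero_co_cauchy: "fam_zero \<in> CC"
proof -
  obtain i where i: "i \<in> I"
    using index_nonempty by blast
  have "fam_zero = fam_push i \<zero>\<^bsub>F i\<^esub>"
    unfolding fam_zero_def fam_push_def
    by (rule restrict_ext) (simp add: i \<phi>_zero)
  then show ?thesis
    using fam_push_co_cauchy[OF i closed(1)[OF i]] by simp
qed

lemma fam_add_co_cauchy:
  assumes x: "x \<in> CC" and y: "y \<in> CC"
  shows "fam_add x y \<in> CC"
proof (rule co_cauchyI)
  show "fam_add x y \<in> (\<Pi>\<^sub>E j\<in>I. carrier (F j))"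
    unfolding fam_add_def using x y by (simp add: closed co_cauchy_mem)
  fix \<epsilon> :: real assume "\<epsilon> > 0"
  then have "\<epsilon>/2 > 0" by simp
  from co_cauchy_small[OF x this] co_cauchy_small[OF y this] eventually_I
  show "\<forall>\<^sub>F i in T. \<forall>j\<in>I. leq i j \<longrightarrow>
      vnorm (F j) (\<phi> i j (fam_add x y i) \<ominus>\<^bsub>F j\<^esub> fam_add x y j) < \<epsilon>"
  proof (eventually_elim, intro ballI impI)
    fix i j
    assume i: "i \<in> I" and j: "j \<in> I" "leq i j"
      and s: "\<forall>j\<in>I. leq i j \<longrightarrow> vnorm (F j) (\<phi> i j (x i) \<ominus>\<^bsub>F j\<^esub> x j) < \<epsilon>/2"
        "\<forall>j\<in>I. leq i j \<longrightarrow> vnorm (F j) (\<phi> i j (y i) \<ominus>\<^bsub>F j\<^esub> y j) < \<epsilon>/2"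
    have "vnorm (F j) (\<phi> i j (fam_add x y i) \<ominus>\<^bsub>F j\<^esub> fam_add x y j)
        \<le> vnorm (F j) (\<phi> i j (x i) \<ominus>\<^bsub>F j\<^esub> x j) + vnorm (F j) (\<phi> i j (y i) \<ominus>\<^bsub>F j\<^esub> y j)"
      using i j x y
      by (simp add: fam_apply \<phi>_add \<phi>_closed co_cauchy_mem normed_vspace.vnorm_add_diff_add_le[OF normed])
    also have "\<dots> < \<epsilon>"
      using bspec[OF s(1) j(1)] bspec[OF s(2) j(1)] j(2) by simp
    finally show "vnorm (F j) (\<phi> i j (fam_add x y i) \<ominus>\<^bsub>F j\<^esub> fam_add x y j) < \<epsilon>" .
  qed
qed

lemma fam_scale_co_cauchy:
  assumes x: "x \<in> CC"
  shows "fam_scale c x \<in> CC"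
proof (rule co_cauchyI)
  show "fam_scale c x \<in> (\<Pi>\<^sub>E j\<in>I. carrier (F j))"
    unfolding fam_scale_def using x by (simp add: closed co_cauchy_mem)
  fix \<epsilon> :: real assume e: "\<epsilon> > 0"
  have pos: "norm c + 1 > 0"
    using norm_ge_zero[of c] by linarith
  then have "\<epsilon> / (norm c + 1) > 0" using e by simp
  from co_cauchy_small[OF x this] eventually_I
  show "\<forall>\<^sub>F i in T. \<forall>j\<in>I. leq i j \<longrightarrow>
      vnorm (F j) (\<phi> i j (fam_scale c x i) \<ominus>\<^bsub>F j\<^esub> fam_scale c x j) < \<epsilon>"
  proof (eventually_elim, intro ballI impI)
    fix i j
    assume i: "i \<in> I" and j: "j \<in> I" "leq i j"
      and s: "\<forall>j\<in>I. leq i j \<longrightarrow> vnorm (F j) (\<phi> i j (x i) \<ominus>\<^bsub>F j\<^esub> x j) < \<epsilon> / (norm c + 1)"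
    let ?d = "vnorm (F j) (\<phi> i j (x i) \<ominus>\<^bsub>F j\<^esub> x j)"
    have m: "\<phi> i j (x i) \<in> carrier (F j)" "x j \<in> carrier (F j)" "x i \<in> carrier (F i)"
      using i j x by (simp_all add: \<phi>_closed co_cauchy_mem)
    have "vnorm (F j) (\<phi> i j (fam_scale c x i) \<ominus>\<^bsub>F j\<^esub> fam_scale c x j) = norm c * ?d"
      using i j m by (simp add: fam_apply \<phi>_scale normed_vspace.vnorm_scale_diff_scale[OF normed])
    also have "\<dots> \<le> ?d * (norm c + 1)"
      using vnorm_ge_0[OF j(1) closed(4)[OF j(1) m(1,2)]] by (simp add: algebra_simps)
    also have "\<dots> < \<epsilon>"
      using bspec[OF s j(1)] j(2) by (simp add: pos_less_divide_eq[OF pos])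
    finally show "vnorm (F j) (\<phi> i j (fam_scale c x i) \<ominus>\<^bsub>F j\<^esub> fam_scale c x j) < \<epsilon>" .
  qed
qed

text \<open>Differences of families are expressed by the operations that descend to the quotient.\<close>

lemma fam_diff_apply:
  assumes "x \<in> CC" "y \<in> CC" "i \<in> I"
  shows "fam_add x (fam_scale (- 1) y) i = x i \<ominus>\<^bsub>F i\<^esub> y i"
  using assms by (simp add: fam_apply co_cauchy_mem normed_vspace.diff_eq_scale[OF normed])

lemma null_rel_iff:
  "(x, y) \<in> R \<longleftrightarrow> x \<in> CC \<and> y \<in> CC \<and> ((\<lambda>i. vnorm (F i) (x i \<ominus>\<^bsub>F i\<^esub> y i)) \<longlongrightarrow> 0) T"
  by (simp add: null_rel_def)

lemma tendsto_0_comparison: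
  assumes "(g \<longlongrightarrow> 0) T" "\<And>i. i \<in> I \<Longrightarrow> u i \<in> carrier (F i)"
    "\<And>i. i \<in> I \<Longrightarrow> vnorm (F i) (u i) \<le> g i"
  shows "((\<lambda>i. vnorm (F i) (u i)) \<longlongrightarrow> 0) T"
proof (rule Lim_null_comparison[OF _ assms(1)])
  from eventually_I show "\<forall>\<^sub>F i in T. norm (vnorm (F i) (u i)) \<le> g i"
    by eventually_elim (simp add: assms(2,3) vnorm_ge_0)
qed

lemma tendsto_cong_I:
  assumes "\<And>i. i \<in> I \<Longrightarrow> f i = g i"
  shows "(f \<longlongrightarrow> l) T \<longleftrightarrow> (g \<longlongrightarrow> l) T"
  by (rule tendsto_cong) (use eventually_I in eventually_elim, rule assms)

lemma equiv_null_rel: "equiv CC R"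
proof (rule equivI)
  show "R \<subseteq> CC \<times> CC"
    unfolding null_rel_def by blast
  show "refl_on CC R"
  proof (rule refl_onI)
    fix x assume x: "x \<in> CC"
    have "((\<lambda>i. vnorm (F i) (x i \<ominus>\<^bsub>F i\<^esub> x i)) \<longlongrightarrow> 0) T \<longleftrightarrow> ((\<lambda>i. 0::real) \<longlongrightarrow> 0) T"
      by (rule tendsto_cong_I)
        (simp add: x co_cauchy_mem normed_vspace.diff_self[OF normed] normed_vspace.vnorm_zero[OF normed])
    then show "(x, x) \<in> R"
      using x by (simp add: null_rel_iff)
  qed
  show "sym R"
  proof (rule symI)
    fix x y assume "(x, y) \<in> R"
    then have xy: "x \<in> CC" "y \<in> CC" "((\<lambda>i. vnorm (F i) (x i \<ominus>\<^bsub>F i\<^esub> y i)) \<longlongrightarrow> 0) T"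
      by (simp_all add: null_rel_iff)
    have "((\<lambda>i. vnorm (F i) (y i \<ominus>\<^bsub>F i\<^esub> x i)) \<longlongrightarrow> 0) T"
      by (rule tendsto_0_comparison[OF xy(3)])
        (use xy(1,2) in \<open>simp_all add: co_cauchy_mem closed normed_vspace.vnorm_diff_commute[OF normed, of _ "y _"]\<close>)
    then show "(y, x) \<in> R"
      using xy by (simp add: null_rel_iff)
  qed
  show "trans R"
  proof (rule transI)
    fix x y z assume "(x, y) \<in> R" "(y, z) \<in> R"
    then have m: "x \<in> CC" "y \<in> CC" "z \<in> CC"
      and t: "((\<lambda>i. vnorm (F i) (x i \<ominus>\<^bsub>F i\<^esub> y i)) \<longlongrightarrow> 0) T"
        "((\<lambda>i. vnorm (F i) (y i \<ominus>\<^bsub>F i\<^esub> z i)) \<longlongrightarrow> 0) T"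
      by (simp_all add: null_rel_iff)
    have "((\<lambda>i. vnorm (F i) (x i \<ominus>\<^bsub>F i\<^esub> z i)) \<longlongrightarrow> 0) T"
      by (rule tendsto_0_comparison[OF tendsto_add_zero[OF t]])
        (use m in \<open>simp_all add: co_cauchy_mem closed normed_vspace.vnorm_diff_triangle[OF normed]\<close>)
    then show "(x, z) \<in> R"
      using m by (simp add: null_rel_iff)
  qed
qed

lemma cls_eq_iff: "x \<in> CC \<Longrightarrow> y \<in> CC \<Longrightarrow> cls x = cls y \<longleftrightarrow> (x, y) \<in> R"
  by (rule eq_equiv_class_iff[OF equiv_null_rel])

lemma carrier_L: "carrier L = CC // R"
  by (simp add: L_space_def)

lemma cls_in_L: "x \<in> CC \<Longrightarrow> cls x \<in> carrier L"
  by (simp add: carrier_L quotientI)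

lemma L_cases:
  assumes "A \<in> carrier L"
  obtains x where "x \<in> CC" "A = cls x"
  using assms unfolding carrier_L by (rule quotientE)

lemma L_zero: "\<zero>\<^bsub>L\<^esub> = cls fam_zero"
  by (simp add: L_space_def fam_zero_def)

lemma fam_add_congruent:
  assumes "(x, x') \<in> R" "(y, y') \<in> R"
  shows "(fam_add x y, fam_add x' y') \<in> R"
proof -
  have m: "x \<in> CC" "x' \<in> CC" "y \<in> CC" "y' \<in> CC"
    and t: "((\<lambda>i. vnorm (F i) (x i \<ominus>\<^bsub>F i\<^esub> x' i)) \<longlongrightarrow> 0) T"
      "((\<lambda>i. vnorm (F i) (y i \<ominus>\<^bsub>F i\<^esub> y' i)) \<longlongrightarrow> 0) T"
    using assms by (simp_all add: null_rel_iff)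
  have "((\<lambda>i. vnorm (F i) (fam_add x y i \<ominus>\<^bsub>F i\<^esub> fam_add x' y' i)) \<longlongrightarrow> 0) T"
    by (rule tendsto_0_comparison[OF tendsto_add_zero[OF t]])
      (use m in \<open>simp_all add: fam_apply co_cauchy_mem closed normed_vspace.vnorm_add_diff_add_le[OF normed]\<close>)
  then show ?thesis
    using m by (simp add: null_rel_iff fam_add_co_cauchy)
qed

lemma fam_scale_congruent:
  assumes "(x, x') \<in> R"
  shows "(fam_scale c x, fam_scale c x') \<in> R"
proof -
  have m: "x \<in> CC" "x' \<in> CC"
    and t: "((\<lambda>i. vnorm (F i) (x i \<ominus>\<^bsub>F i\<^esub> x' i)) \<longlongrightarrow> 0) T"
    using assms by (simp_all add: null_rel_iff)
  have "((\<lambda>i. vnorm (F i) (fam_scale c x i \<ominus>\<^bsub>F i\<^esub> fam_scale c x' i)) \<longlongrightarrow> 0) T"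
    by (rule tendsto_0_comparison[OF tendsto_mult_right_zero[OF t, of "norm c"]])
      (use m in \<open>simp_all add: fam_apply co_cauchy_mem closed normed_vspace.vnorm_scale_diff_scale[OF normed]\<close>)
  then show ?thesis
    using m by (simp add: null_rel_iff fam_scale_co_cauchy)
qed

lemma L_add:
  assumes "x \<in> CC" "y \<in> CC"
  shows "cls x \<oplus>\<^bsub>L\<^esub> cls y = cls (fam_add x y)"
proof -
  have "congruent2 R R (\<lambda>x y. cls (fam_add x y))"
    by (rule congruent2I', rule equiv_class_eq[OF equiv_null_rel], rule fam_add_congruent)
  from UN_equiv_class2[OF equiv_null_rel equiv_null_rel this assms]
  show ?thesis
    by (simp add: L_space_def fam_add_def)
qed

lemma L_scale:
  assumes "x \<in> CC"
  shows "c \<odot>\<^bsub>L\<^esub> cls x = cls (fam_scale c x)"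
proof -
  have "congruent R (\<lambda>x. cls (fam_scale c x))"
    by (rule congruentI, rule equiv_class_eq[OF equiv_null_rel], rule fam_scale_congruent)
  from UN_equiv_class[OF equiv_null_rel this assms]
  show ?thesis
    by (simp add: L_space_def fam_scale_def)
qed

text \<open>Since the connecting maps preserve norms, the norms of a co-Cauchy family form a Cauchy net
  of reals.\<close>

lemma vnorm_net_converges:
  assumes x: "x \<in> CC"
  shows "\<exists>r. ((\<lambda>i. vnorm (F i) (x i)) \<longlongrightarrow> r) T"
proof (rule real_Cauchy_net_converges[OF directed])
  fix \<epsilon> :: real assume "\<epsilon> > 0"
  obtain l where l: "l \<in> I"
    and s: "\<forall>i\<in>I. leq l i \<longrightarrow> (\<forall>j\<in>I. leq i j \<longrightarrow> vnorm (F j) (\<phi> i j (x i) \<ominus>\<^bsub>F j\<^esub> x j) < \<epsilon>)"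
    using co_cauchy_small[OF x \<open>\<epsilon> > 0\<close>] unfolding eventually_T by blast
  have "\<bar>vnorm (F l) (x l) - vnorm (F i) (x i)\<bar> < \<epsilon>" if i: "i \<in> I" "leq l i" for i
  proof -
    have "\<bar>vnorm (F i) (\<phi> l i (x l)) - vnorm (F i) (x i)\<bar> \<le> vnorm (F i) (\<phi> l i (x l) \<ominus>\<^bsub>F i\<^esub> x i)"
      using i l x by (simp add: \<phi>_closed co_cauchy_mem normed_vspace.abs_vnorm_diff_le[OF normed])
    moreover have "vnorm (F i) (\<phi> l i (x l) \<ominus>\<^bsub>F i\<^esub> x i) < \<epsilon>"
      using s l i index_refl[OF l] by blast
    moreover have "vnorm (F i) (\<phi> l i (x l)) = vnorm (F l) (x l)"
      using i l x by (simp add: vnorm_\<phi> co_cauchy_mem)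
    ultimately show ?thesis by linarith
  qed
  then show "\<exists>l\<in>I. \<forall>i\<in>I. leq l i \<longrightarrow> \<bar>vnorm (F l) (x l) - vnorm (F i) (x i)\<bar> < \<epsilon>"
    using l by blast
qed

text \<open>The definite description in the norm picks out a real number that is a limit for every
  representative, so the limit has to be the same for all of them.\<close>

lemma vnorm_L:
  assumes x: "x \<in> CC"
  shows "((\<lambda>i. vnorm (F i) (x i)) \<longlongrightarrow> vnorm L (cls x)) T"
proof -
  obtain r where r: "((\<lambda>i. vnorm (F i) (x i)) \<longlongrightarrow> r) T"
    using vnorm_net_converges[OF x] by blast
  have all: "((\<lambda>i. vnorm (F i) (y i)) \<longlongrightarrow> r) T" if "y \<in> cls x" for y
  proof -
    have y: "y \<in> CC" and t: "((\<lambda>i. vnorm (F i) (x i \<ominus>\<^bsub>F i\<^esub> y i)) \<longlongrightarrow> 0) T"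
      using that by (simp_all add: null_rel_iff)
    have "((\<lambda>i. vnorm (F i) (y i) - vnorm (F i) (x i)) \<longlongrightarrow> 0) T"
    proof (rule Lim_null_comparison[OF _ t])
      from eventually_I
      show "\<forall>\<^sub>F i in T. norm (vnorm (F i) (y i) - vnorm (F i) (x i)) \<le> vnorm (F i) (x i \<ominus>\<^bsub>F i\<^esub> y i)"
      proof eventually_elim
        case (elim i)
        show ?case
          using normed_vspace.abs_vnorm_diff_le[OF normed[OF elim] co_cauchy_mem[OF x elim] co_cauchy_mem[OF y elim]]
          by (simp add: abs_minus_commute)
      qed
    qed
    from tendsto_add[OF this r] show ?thesis by simp
  qed
  have "x \<in> cls x"
    by (rule equiv_class_self[OF equiv_null_rel x])
  then have "(THE r. \<forall>x\<in>cls x. ((\<lambda>i. vnorm (F i) (x i)) \<longlongrightarrow> r) T) = r"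
    using all tendsto_unique[OF T_neq_bot] by (intro the_equality) blast+
  then have "vnorm L (cls x) = r"
    by (simp add: L_space_def)
  then show ?thesis using r by simp
qed

lemmas fam_co_cauchy = fam_zero_co_cauchy fam_add_co_cauchy fam_scale_co_cauchy

end

section \<open>The normed space of classes and its canonical maps\<close>

context directed_codiagram
begin

lemma module_F: "i \<in> I \<Longrightarrow> Module.module ring_of_type_algebra (F i)"
  by (rule normed_vspace.axioms(1)[OF normed])

lemma abelian_monoid_F: "i \<in> I \<Longrightarrow> abelian_monoid (F i)"
  by (rule abelian_group.axioms(1)[OF module.axioms(2)[OF module_F]])

lemma cls_cong:
  assumes "x \<in> CC" "y \<in> CC" "\<And>i. i \<in> I \<Longrightarrow> x i = y i"
  shows "cls x = cls y"
  using PiE_ext[OF co_cauchy_PiE[OF assms(1)] co_cauchy_PiE[OF assms(2)] assms(3)] by simp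

text \<open>Each law holds in \<open>L\<close> since it holds in every \<open>F i\<close>: on representatives both sides are the
  same family.\<close>

lemma abelian_group_L: "abelian_group L"
proof (rule abelian_groupI)
  show "\<zero>\<^bsub>L\<^esub> \<in> carrier L"
    unfolding L_zero by (rule cls_in_L[OF fam_zero_co_cauchy])
  fix A assume "A \<in> carrier L"
  then obtain x where x: "x \<in> CC" "A = cls x"
    by (rule L_cases)
  show "\<zero>\<^bsub>L\<^esub> \<oplus>\<^bsub>L\<^esub> A = A"
    unfolding x(2) L_zero L_add[OF fam_zero_co_cauchy x(1)]
    using x(1) by (intro cls_cong)
      (simp_all add: fam_co_cauchy fam_apply co_cauchy_mem abelian_monoid.l_zero[OF abelian_monoid_F])
  show "\<exists>B\<in>carrier L. B \<oplus>\<^bsub>L\<^esub> A = \<zero>\<^bsub>L\<^esub>"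
  proof (rule bexI)
    show "cls (fam_scale (- 1) x) \<oplus>\<^bsub>L\<^esub> A = \<zero>\<^bsub>L\<^esub>"
      unfolding x(2) L_zero L_add[OF fam_scale_co_cauchy[OF x(1)] x(1)]
      using x(1) by (intro cls_cong)
        (simp_all add: fam_co_cauchy fam_apply co_cauchy_mem normed_vspace.scale_minus_one_add[OF normed])
    show "cls (fam_scale (- 1) x) \<in> carrier L"
      by (rule cls_in_L[OF fam_scale_co_cauchy[OF x(1)]])
  qed
  fix B assume "B \<in> carrier L"
  then obtain y where y: "y \<in> CC" "B = cls y"
    by (rule L_cases)
  show "A \<oplus>\<^bsub>L\<^esub> B \<in> carrier L"
    using x y by (simp add: L_add cls_in_L fam_co_cauchy)
  show "A \<oplus>\<^bsub>L\<^esub> B = B \<oplus>\<^bsub>L\<^esub> A"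
    unfolding x(2) y(2) L_add[OF x(1) y(1)] L_add[OF y(1) x(1)]
    using x(1) y(1) by (intro cls_cong)
      (simp_all add: fam_co_cauchy fam_apply co_cauchy_mem abelian_monoid.a_comm[OF abelian_monoid_F])
  fix C assume "C \<in> carrier L"
  then obtain z where z: "z \<in> CC" "C = cls z"
    by (rule L_cases)
  show "A \<oplus>\<^bsub>L\<^esub> B \<oplus>\<^bsub>L\<^esub> C = A \<oplus>\<^bsub>L\<^esub> (B \<oplus>\<^bsub>L\<^esub> C)"
    unfolding x(2) y(2) z(2) L_add[OF x(1) y(1)] L_add[OF y(1) z(1)]
      L_add[OF fam_add_co_cauchy[OF x(1) y(1)] z(1)] L_add[OF x(1) fam_add_co_cauchy[OF y(1) z(1)]]
    using x(1) y(1) z(1) by (intro cls_cong)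
      (simp_all add: fam_co_cauchy fam_apply co_cauchy_mem abelian_monoid.a_assoc[OF abelian_monoid_F])
qed

lemma module_L: "Module.module ring_of_type_algebra L"
proof (rule moduleI)
  obtain i where "i \<in> I"
    using index_nonempty by blast
  then show "cring (ring_of_type_algebra :: 'k ring)"
    by (rule module.axioms(1)[OF module_F])
  show "abelian_group L"
    by (rule abelian_group_L)
  fix c d :: 'k and A assume "A \<in> carrier L"
  then obtain x where x: "x \<in> CC" "A = cls x"
    by (rule L_cases)
  show "c \<odot>\<^bsub>L\<^esub> A \<in> carrier L"
    using x by (simp add: L_scale cls_in_L fam_co_cauchy)
  show "\<one>\<^bsub>ring_of_type_algebra\<^esub> \<odot>\<^bsub>L\<^esub> A = A"
    unfolding ring_of_type_simps x(2) L_scale[OF x(1)]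
    using x(1) by (intro cls_cong)
      (simp_all add: fam_co_cauchy fam_apply co_cauchy_mem normed_vspace.scale_one[OF normed])
  show "(c \<otimes>\<^bsub>ring_of_type_algebra\<^esub> d) \<odot>\<^bsub>L\<^esub> A = c \<odot>\<^bsub>L\<^esub> (d \<odot>\<^bsub>L\<^esub> A)"
    unfolding ring_of_type_simps x(2) L_scale[OF x(1)] L_scale[OF fam_scale_co_cauchy[OF x(1)]]
    using x(1) by (intro cls_cong)
      (simp_all add: fam_co_cauchy fam_apply co_cauchy_mem normed_vspace.scale_scale[OF normed])
  show "(c \<oplus>\<^bsub>ring_of_type_algebra\<^esub> d) \<odot>\<^bsub>L\<^esub> A = c \<odot>\<^bsub>L\<^esub> A \<oplus>\<^bsub>L\<^esub> d \<odot>\<^bsub>L\<^esub> A"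
    unfolding ring_of_type_simps x(2) L_scale[OF x(1)]
      L_add[OF fam_scale_co_cauchy[OF x(1)] fam_scale_co_cauchy[OF x(1)]]
    using x(1) by (intro cls_cong)
      (simp_all add: fam_co_cauchy fam_apply co_cauchy_mem normed_vspace.scale_add_left[OF normed])
  fix B assume "B \<in> carrier L"
  then obtain y where y: "y \<in> CC" "B = cls y"
    by (rule L_cases)
  show "c \<odot>\<^bsub>L\<^esub> (A \<oplus>\<^bsub>L\<^esub> B) = c \<odot>\<^bsub>L\<^esub> A \<oplus>\<^bsub>L\<^esub> c \<odot>\<^bsub>L\<^esub> B"
    unfolding x(2) y(2) L_scale[OF x(1)] L_scale[OF y(1)] L_add[OF x(1) y(1)]
      L_add[OF fam_scale_co_cauchy[OF x(1)] fam_scale_co_cauchy[OF y(1)]]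
      L_scale[OF fam_add_co_cauchy[OF x(1) y(1)]]
    using x(1) y(1) by (intro cls_cong)
      (simp_all add: fam_co_cauchy fam_apply co_cauchy_mem normed_vspace.scale_add_right[OF normed])
qed

lemma vnorm_L_unique:
  assumes "x \<in> CC" "((\<lambda>i. vnorm (F i) (x i)) \<longlongrightarrow> r) T"
  shows "vnorm L (cls x) = r"
  using tendsto_unique[OF T_neq_bot vnorm_L[OF assms(1)] assms(2)] .

lemma normed_vspace_L: "normed_vspace L"
proof (intro normed_vspace.intro normed_vspace_axioms.intro module_L)
  fix A assume "A \<in> carrier L"
  then obtain x where x: "x \<in> CC" "A = cls x"
    by (rule L_cases)
  show "0 \<le> vnorm L A"
  proof (rule tendsto_lowerbound[OF vnorm_L[OF x(1), folded x(2)] _ T_neq_bot])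
    from eventually_I show "\<forall>\<^sub>F i in T. 0 \<le> vnorm (F i) (x i)"
      by eventually_elim (simp add: x(1) co_cauchy_mem vnorm_ge_0)
  qed
  have "vnorm L A = 0 \<longleftrightarrow> ((\<lambda>i. vnorm (F i) (x i)) \<longlongrightarrow> 0) T"
    using vnorm_L[OF x(1)] vnorm_L_unique[OF x(1)] x(2) by metis
  also have "\<dots> \<longleftrightarrow> ((\<lambda>i. vnorm (F i) (x i \<ominus>\<^bsub>F i\<^esub> fam_zero i)) \<longlongrightarrow> 0) T"
    by (rule tendsto_cong_I)
      (simp add: fam_apply x(1) co_cauchy_mem normed_vspace.diff_zero[OF normed])
  also have "\<dots> \<longleftrightarrow> A = \<zero>\<^bsub>L\<^esub>"
    unfolding x(2) L_zero cls_eq_iff[OF x(1) fam_zero_co_cauchy]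
    by (simp add: null_rel_iff x(1) fam_zero_co_cauchy)
  finally show "vnorm L A = 0 \<longleftrightarrow> A = \<zero>\<^bsub>L\<^esub>" .
  show "vnorm L (c \<odot>\<^bsub>L\<^esub> A) = norm c * vnorm L A" for c
    unfolding x(2) L_scale[OF x(1)]
  proof (rule vnorm_L_unique[OF fam_scale_co_cauchy[OF x(1)]])
    have "((\<lambda>i. norm c * vnorm (F i) (x i)) \<longlongrightarrow> norm c * vnorm L (cls x)) T"
      by (rule tendsto_mult_left[OF vnorm_L[OF x(1)]])
    then show "((\<lambda>i. vnorm (F i) (fam_scale c x i)) \<longlongrightarrow> norm c * vnorm L (cls x)) T"
      by (subst tendsto_cong_I[of _ "\<lambda>i. norm c * vnorm (F i) (x i)"])
        (simp_all add: fam_apply x(1) co_cauchy_mem normed_vspace.vnorm_smult[OF normed])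
  qed
  fix B assume "B \<in> carrier L"
  then obtain y where y: "y \<in> CC" "B = cls y"
    by (rule L_cases)
  show "vnorm L (A \<oplus>\<^bsub>L\<^esub> B) \<le> vnorm L A + vnorm L B"
    unfolding x(2) y(2) L_add[OF x(1) y(1)]
  proof (rule tendsto_le[OF T_neq_bot tendsto_add[OF vnorm_L[OF x(1)] vnorm_L[OF y(1)]]
        vnorm_L[OF fam_add_co_cauchy[OF x(1) y(1)]]])
    from eventually_I
    show "\<forall>\<^sub>F i in T. vnorm (F i) (fam_add x y i) \<le> vnorm (F i) (x i) + vnorm (F i) (y i)"
      by eventually_elim
        (simp add: fam_apply x(1) y(1) co_cauchy_mem normed_vspace.vnorm_triangle[OF normed])
  qed
qed

lemma vnorm_L_diff:
  assumes x: "x \<in> CC" and y: "y \<in> CC"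
  shows "((\<lambda>i. vnorm (F i) (x i \<ominus>\<^bsub>F i\<^esub> y i)) \<longlongrightarrow> vnorm L (cls x \<ominus>\<^bsub>L\<^esub> cls y)) T"
proof -
  have "cls x \<ominus>\<^bsub>L\<^esub> cls y = cls (fam_add x (fam_scale (- 1) y))"
    using x y by (simp add: normed_vspace.diff_eq_scale[OF normed_vspace_L] cls_in_L L_scale L_add
        fam_co_cauchy)
  with vnorm_L[OF fam_add_co_cauchy[OF x fam_scale_co_cauchy[OF y]]]
  have "((\<lambda>i. vnorm (F i) (fam_add x (fam_scale (- 1) y) i)) \<longlongrightarrow> vnorm L (cls x \<ominus>\<^bsub>L\<^esub> cls y)) T"
    by simp
  then show ?thesis
    by (subst tendsto_cong_I) (simp_all add: fam_diff_apply x y)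
qed

lemma vnorm_L_diff_le:
  assumes x: "x \<in> CC" and y: "y \<in> CC"
    and le: "\<forall>\<^sub>F i in T. vnorm (F i) (x i \<ominus>\<^bsub>F i\<^esub> y i) \<le> r"
  shows "vnorm L (cls x \<ominus>\<^bsub>L\<^esub> cls y) \<le> r"
  by (rule tendsto_upperbound[OF vnorm_L_diff[OF x y] le T_neq_bot])

lemma L_map_eq: "L_map I leq F \<phi> i a = cls (fam_push i a)"
  by (simp add: L_map_def fam_push_def)

lemma linear_isometry_L_map:
  assumes i: "i \<in> I"
  shows "linear_isometry (F i) L (L_map I leq F \<phi> i)"
  unfolding linear_isometry_def L_map_eq
proof (intro conjI ballI allI)
  show "(\<lambda>a. cls (fam_push i a)) \<in> carrier (F i) \<rightarrow> carrier L"
    by (simp add: cls_in_L fam_push_co_cauchy i)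
  fix a assume a: "a \<in> carrier (F i)"
  show "cls (fam_push i (c \<odot>\<^bsub>F i\<^esub> a)) = c \<odot>\<^bsub>L\<^esub> cls (fam_push i a)" for c
    unfolding L_scale[OF fam_push_co_cauchy[OF i a]]
    using i a by (intro cls_cong) (simp_all add: fam_co_cauchy fam_push_co_cauchy closed fam_apply
        \<phi>_scale module.smult_r_null[OF module_F] ring_of_type_simps)
  show "vnorm L (cls (fam_push i a)) = vnorm (F i) a"
  proof (rule vnorm_L_unique[OF fam_push_co_cauchy[OF i a]])
    from eventually_above[OF i]
    have "\<forall>\<^sub>F j in T. vnorm (F j) (fam_push i a j) = vnorm (F i) a"
      by eventually_elim (simp add: fam_apply i a vnorm_\<phi>)
    then show "((\<lambda>j. vnorm (F j) (fam_push i a j)) \<longlongrightarrow> vnorm (F i) a) T"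
      by (rule tendsto_eventually)
  qed
  fix b assume b: "b \<in> carrier (F i)"
  show "cls (fam_push i (a \<oplus>\<^bsub>F i\<^esub> b)) = cls (fam_push i a) \<oplus>\<^bsub>L\<^esub> cls (fam_push i b)"
    unfolding L_add[OF fam_push_co_cauchy[OF i a] fam_push_co_cauchy[OF i b]]
    using i a b by (intro cls_cong) (simp_all add: fam_co_cauchy fam_push_co_cauchy closed fam_apply
        \<phi>_add abelian_monoid.l_zero[OF abelian_monoid_F])
qed

lemma L_map_compatible:
  assumes ij: "i \<in> I" "j \<in> I" "leq i j" and a: "a \<in> carrier (F i)"
  shows "L_map I leq F \<phi> i a = L_map I leq F \<phi> j (\<phi> i j a)"
proof -
  have b: "\<phi> i j a \<in> carrier (F j)"
    by (rule \<phi>_closed[OF ij a])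
  have cc: "fam_push i a \<in> CC" "fam_push j (\<phi> i j a) \<in> CC"
    by (rule fam_push_co_cauchy; fact)+
  from eventually_above[OF ij(2)]
  have "\<forall>\<^sub>F k in T. vnorm (F k) (fam_push i a k \<ominus>\<^bsub>F k\<^esub> fam_push j (\<phi> i j a) k) = 0"
  proof eventually_elim
    case (elim k)
    then have "leq i k"
      using index_trans ij by blast
    then show ?case
      using elim ij a by (simp add: fam_apply \<phi>_comp \<phi>_closed normed_vspace.diff_self[OF normed]
          normed_vspace.vnorm_zero[OF normed])
  qed
  then have "((\<lambda>k. vnorm (F k) (fam_push i a k \<ominus>\<^bsub>F k\<^esub> fam_push j (\<phi> i j a) k)) \<longlongrightarrow> 0) T"
    by (rule tendsto_eventually)
  then show ?thesis
    unfolding L_map_eq cls_eq_iff[OF cc] null_rel_iff using cc by blast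
qed

text \<open>The images of the canonical maps are dense, in the explicit form that a family traces out
  its own class.\<close>

lemma L_map_vlim:
  assumes x: "x \<in> CC"
  shows "vlim L (\<lambda>i. L_map I leq F \<phi> i (x i)) (cls x) T"
  unfolding vlim_def
proof (intro conjI)
  show "cls x \<in> carrier L"
    by (rule cls_in_L[OF x])
  from eventually_I show "\<forall>\<^sub>F i in T. L_map I leq F \<phi> i (x i) \<in> carrier L"
    unfolding L_map_eq by eventually_elim (intro cls_in_L fam_push_co_cauchy co_cauchy_mem x)
  show "((\<lambda>i. vnorm L (L_map I leq F \<phi> i (x i) \<ominus>\<^bsub>L\<^esub> cls x)) \<longlongrightarrow> 0) T"
  proof (rule tendstoI)
    fix \<epsilon> :: real assume e: "\<epsilon> > 0"
    from co_cauchy_small[OF x half_gt_zero[OF e]] eventually_I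
    show "\<forall>\<^sub>F i in T. dist (vnorm L (L_map I leq F \<phi> i (x i) \<ominus>\<^bsub>L\<^esub> cls x)) 0 < \<epsilon>"
    proof eventually_elim
      case (elim i)
      have p: "fam_push i (x i) \<in> CC"
        by (intro fam_push_co_cauchy co_cauchy_mem x elim(2))
      have "vnorm L (cls (fam_push i (x i)) \<ominus>\<^bsub>L\<^esub> cls x) \<le> \<epsilon>/2"
      proof (rule vnorm_L_diff_le[OF p x])
        from eventually_above[OF elim(2)]
        show "\<forall>\<^sub>F j in T. vnorm (F j) (fam_push i (x i) j \<ominus>\<^bsub>F j\<^esub> x j) \<le> \<epsilon>/2"
          by eventually_elim (use elim(1) in \<open>simp add: fam_apply less_imp_le\<close>)
      qed
      moreover have "0 \<le> vnorm L (cls (fam_push i (x i)) \<ominus>\<^bsub>L\<^esub> cls x)"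
        by (intro normed_vspace.vnorm_nonneg[OF normed_vspace_L]
            normed_vspace.diff_closed[OF normed_vspace_L] cls_in_L p x)
      ultimately show ?case
        using e by (simp add: L_map_eq)
    qed
  qed
qed

end

section \<open>Completeness\<close>

text \<open>Conditions \<open>Q n\<close> that each hold on some tail hold simultaneously along a level function \<open>\<nu>\<close>
  that still tends to infinity. Over the natural numbers this is the usual diagonal argument; in
  general it needs a chain without upper bound.\<close>

lemma E_property_diagonal:
  assumes dir: "directed_preorder I leq" and E: "E_property I leq"
    and Q: "\<And>n. \<forall>\<^sub>F i in tail_filter I leq. Q n i"
  obtains \<nu> :: "'i \<Rightarrow> nat" where "\<And>n. \<forall>\<^sub>F i in tail_filter I leq. n \<le> \<nu> i \<and> Q (\<nu> i) i"
proof -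
  have refl: "leq i i" if "i \<in> I" for i
    using dir that unfolding directed_preorder_def by blast
  have trans: "leq i k" if "leq i j" "leq j k" "i \<in> I" "j \<in> I" "k \<in> I" for i j k
    using dir that unfolding directed_preorder_def by blast
  have upper: "\<exists>k\<in>I. leq i k \<and> leq j k" if "i \<in> I" "j \<in> I" for i j
    using dir that unfolding directed_preorder_def by blast
  define P where "P n l \<longleftrightarrow> l \<in> I \<and> (\<forall>i\<in>I. leq l i \<longrightarrow> Q n i)" for n l
  have ex: "\<exists>k. P n k \<and> strict_part leq l k" if l: "l \<in> I" for n l
  proof -
    obtain m where m: "m \<in> I" "\<forall>i\<in>I. leq m i \<longrightarrow> Q n i"
      using Q[of n] unfolding eventually_tail_filter[OF dir] by blast
    obtain k where k: "k \<in> I" "leq l k" "leq m k"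
      using upper[OF l m(1)] by blast
    obtain k' where k': "k' \<in> I" "leq k k'" "\<not> leq k' k"
      using E k(1) unfolding E_property_def strict_part_def by blast
    have "leq m k'" "leq l k'"
      using trans k k' m(1) l by blast+
    moreover have "\<not> leq k' l"
      using trans[of k' l k] k k' l by blast
    moreover have "P n k'"
      unfolding P_def using m trans[OF \<open>leq m k'\<close>] k'(1) by blast
    ultimately show ?thesis
      unfolding strict_part_def by blast
  qed
  have "\<exists>c. \<forall>n. P n (c n) \<and> strict_part leq (c n) (c (Suc n))"
  proof (rule dependent_nat_choice[of P "\<lambda>_. strict_part leq"])
    obtain l where "l \<in> I"
      using dir unfolding directed_preorder_def by blast
    then show "\<exists>k. P 0 k"
      using ex[of l 0] by blast
    show "\<exists>k. P (Suc n) k \<and> strict_part leq l k" if "P n l" for n l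
    proof -
      have "l \<in> I"
        using that unfolding P_def by blast
      then show ?thesis
        by (rule ex)
    qed
  qed
  then obtain c where c: "\<And>n. P n (c n)" "\<And>n. strict_part leq (c n) (c (Suc n))"
    by blast
  have cI: "c n \<in> I" for n
    using c(1)[of n] unfolding P_def by blast
  have mono: "leq (c n) (c m)" if "n \<le> m" for n m
    using that
  proof (induction rule: dec_induct)
    case base
    then show ?case by (rule refl[OF cI])
  next
    case (step k)
    have "leq (c k) (c (Suc k))"
      using c(2)[of k] unfolding strict_part_def by blast
    then show ?case
      using trans[OF step.IH] cI by blast
  qed
  have "range c \<subseteq> I"
    using cI by blast
  then have unbounded: "\<exists>n. \<not> leq (c n) i" if "i \<in> I" for i
    using E c(2) that unfolding E_property_def by blast
  \<comment> \<open>One less than the first member of the chain not below \<open>i\<close>. If already \<open>c 0\<close> is not below \<open>i\<close>,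
    truncated subtraction gives the value \<open>0\<close>; what is claimed of \<open>\<nu>\<close> concerns only the tail above \<open>c 0\<close>.\<close>
  define \<nu> where "\<nu> i = (LEAST n. \<not> leq (c n) i) - 1" for i
  have \<nu>: "n \<le> \<nu> i \<and> leq (c (\<nu> i)) i" if i: "i \<in> I" "leq (c n) i" for n i
  proof -
    let ?m = "LEAST n. \<not> leq (c n) i"
    have m: "\<not> leq (c ?m) i"
      using unbounded[OF i(1)] by (rule LeastI_ex)
    have "n < ?m"
    proof (rule ccontr)
      assume "\<not> n < ?m"
      then have "leq (c ?m) (c n)"
        by (intro mono) simp
      then show False
        using trans[OF _ i(2) cI cI i(1)] m by blast
    qed
    then have "n \<le> \<nu> i" "\<nu> i < ?m"
      unfolding \<nu>_def by simp_all
    then show ?thesis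
      using not_less_Least[of "\<nu> i" "\<lambda>n. \<not> leq (c n) i"] by blast
  qed
  have "\<forall>\<^sub>F i in tail_filter I leq. n \<le> \<nu> i \<and> Q (\<nu> i) i" for n
    unfolding eventually_tail_filter[OF dir]
  proof (intro bexI[OF _ cI[of n]] ballI impI)
    fix i assume i: "i \<in> I" "leq (c n) i"
    then show "n \<le> \<nu> i \<and> Q (\<nu> i) i"
      using \<nu>[OF i] c(1)[of "\<nu> i"] unfolding P_def by blast
  qed
  then show ?thesis
    by (rule that)
qed

context directed_codiagram
begin

lemma eventually_future:
  assumes "eventually P T"
  shows "\<forall>\<^sub>F i in T. \<forall>j\<in>I. leq i j \<longrightarrow> P j"
proof -
  obtain l where l: "l \<in> I" "\<forall>i\<in>I. leq l i \<longrightarrow> P i"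
    using assms unfolding eventually_T by blast
  have "\<forall>i\<in>I. leq l i \<longrightarrow> (\<forall>j\<in>I. leq i j \<longrightarrow> P j)"
    using l index_trans by blast
  then show ?thesis
    unfolding eventually_T using l(1) by blast
qed

text \<open>A family that is uniformly approximated on tails by co-Cauchy families is co-Cauchy, by the
  three-epsilon argument through \<open>\<phi>\<^sub>i\<^sub>j (x i)\<close> and \<open>x j\<close>.\<close>

lemma co_cauchy_uniform_limit:
  assumes y: "y \<in> (\<Pi>\<^sub>E i\<in>I. carrier (F i))"
    and approx: "\<And>\<epsilon>. \<epsilon> > 0 \<Longrightarrow> \<exists>x\<in>CC. \<forall>\<^sub>F i in T. vnorm (F i) (x i \<ominus>\<^bsub>F i\<^esub> y i) < \<epsilon>"
  shows "y \<in> CC"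
proof (rule co_cauchyI[OF y])
  fix \<epsilon> :: real assume "\<epsilon> > 0"
  then have e: "\<epsilon>/3 > 0" by simp
  obtain x where x: "x \<in> CC" and near: "\<forall>\<^sub>F i in T. vnorm (F i) (x i \<ominus>\<^bsub>F i\<^esub> y i) < \<epsilon>/3"
    using approx[OF e] by blast
  from co_cauchy_small[OF x e] eventually_future[OF near] eventually_I
  show "\<forall>\<^sub>F i in T. \<forall>j\<in>I. leq i j \<longrightarrow> vnorm (F j) (\<phi> i j (y i) \<ominus>\<^bsub>F j\<^esub> y j) < \<epsilon>"
  proof (eventually_elim, intro ballI impI)
    fix i j
    assume i: "i \<in> I" and j: "j \<in> I" "leq i j"
      and s: "\<forall>j\<in>I. leq i j \<longrightarrow> vnorm (F j) (\<phi> i j (x i) \<ominus>\<^bsub>F j\<^esub> x j) < \<epsilon>/3"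
        "\<forall>j\<in>I. leq i j \<longrightarrow> vnorm (F j) (x j \<ominus>\<^bsub>F j\<^esub> y j) < \<epsilon>/3"
    interpret Fj: normed_vspace "F j" by (rule normed[OF j(1)])
    have m: "x i \<in> carrier (F i)" "y i \<in> carrier (F i)" "x j \<in> carrier (F j)" "y j \<in> carrier (F j)"
      using co_cauchy_mem[OF x] y i j(1) by blast+
    have n: "\<phi> i j (x i) \<in> carrier (F j)" "\<phi> i j (y i) \<in> carrier (F j)"
      using \<phi>_closed[OF i j] m by blast+
    have "vnorm (F j) (\<phi> i j (x i) \<ominus>\<^bsub>F j\<^esub> x j) < \<epsilon>/3" "vnorm (F j) (x j \<ominus>\<^bsub>F j\<^esub> y j) < \<epsilon>/3"
      "vnorm (F i) (x i \<ominus>\<^bsub>F i\<^esub> y i) < \<epsilon>/3"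
      using s i j index_refl[OF i] by blast+
    moreover have "vnorm (F j) (\<phi> i j (y i) \<ominus>\<^bsub>F j\<^esub> \<phi> i j (x i)) = vnorm (F i) (x i \<ominus>\<^bsub>F i\<^esub> y i)"
      using vnorm_\<phi>_diff[OF i j m(1,2)] Fj.vnorm_diff_commute[OF n] by linarith
    ultimately show "vnorm (F j) (\<phi> i j (y i) \<ominus>\<^bsub>F j\<^esub> y j) < \<epsilon>"
      using Fj.vnorm_diff_triangle[OF n(2) n(1) m(4)] Fj.vnorm_diff_triangle[OF n(1) m(3,4)]
      by linarith
  qed
qed

text \<open>The limit of a Cauchy sequence of classes is represented by a diagonal family along a level
  function for the conditions \<open>Q n\<close>: at the index \<open>i\<close>, the representatives up to level \<open>n\<close> are
  about as close to the \<open>n\<close>-th one as their classes are.\<close>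

lemma complete_L:
  assumes E: "E_property I leq"
  shows "Metric_space.mcomplete (carrier L) (vdist L)"
proof -
  interpret L: normed_vspace L by (rule normed_vspace_L)
  interpret D: Metric_space "carrier L" "vdist L" by (rule L.Metric_space_vdist)
  show ?thesis
    unfolding D.mcomplete_def
  proof (intro allI impI)
    fix \<sigma> assume \<sigma>: "D.MCauchy \<sigma>"
    have "\<exists>x. x \<in> CC \<and> \<sigma> n = cls x" for n
    proof -
      have "\<sigma> n \<in> carrier L"
        using \<sigma> unfolding D.MCauchy_def by blast
      then show ?thesis
        by (elim L_cases) blast
    qed
    then obtain x where x: "\<And>n. x n \<in> CC" "\<And>n. \<sigma> n = cls (x n)"
      by metis
    let ?e = "\<lambda>n. inverse (real (Suc n))"
    define Q where "Q n i \<longleftrightarrow> (\<forall>m\<in>{..n}. vnorm (F i) (x m i \<ominus>\<^bsub>F i\<^esub> x n i) < vdist L (\<sigma> m) (\<sigma> n) + ?e n)" for n i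
    have "\<forall>\<^sub>F i in T. Q n i" for n
      unfolding Q_def
    proof (rule eventually_ball_finite[OF finite_atMost], rule ballI)
      fix m
      have "vnorm L (cls (x m) \<ominus>\<^bsub>L\<^esub> cls (x n)) < vdist L (\<sigma> m) (\<sigma> n) + ?e n"
        by (simp add: x L.vdist_eq cls_in_L)
      then show "\<forall>\<^sub>F i in T. vnorm (F i) (x m i \<ominus>\<^bsub>F i\<^esub> x n i) < vdist L (\<sigma> m) (\<sigma> n) + ?e n"
        by (rule order_tendstoD(2)[OF vnorm_L_diff[OF x(1) x(1)]])
    qed
    then obtain \<nu> :: "'i \<Rightarrow> nat" where \<nu>: "\<And>n. \<forall>\<^sub>F i in T. n \<le> \<nu> i \<and> Q (\<nu> i) i"
      using E_property_diagonal[OF directed E, of Q] by blast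
    define y where "y = (\<lambda>i\<in>I. x (\<nu> i) i)"
    have yPi: "y \<in> (\<Pi>\<^sub>E i\<in>I. carrier (F i))"
      unfolding y_def by (simp add: co_cauchy_mem x(1))
    have near: "\<exists>N. \<forall>n\<ge>N. \<forall>\<^sub>F i in T. vnorm (F i) (x n i \<ominus>\<^bsub>F i\<^esub> y i) < \<epsilon>" if "\<epsilon> > 0" for \<epsilon>
    proof -
      have "\<epsilon>/2 > 0" using that by simp
      obtain N1 where N1: "?e N1 < \<epsilon>/2"
        using reals_Archimedean[OF \<open>\<epsilon>/2 > 0\<close>] by blast
      obtain N2 where N2: "\<And>n n'. N2 \<le> n \<Longrightarrow> N2 \<le> n' \<Longrightarrow> vdist L (\<sigma> n) (\<sigma> n') < \<epsilon>/2"
        using \<sigma> \<open>\<epsilon>/2 > 0\<close> unfolding D.MCauchy_def by blast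
      have "\<forall>\<^sub>F i in T. vnorm (F i) (x n i \<ominus>\<^bsub>F i\<^esub> y i) < \<epsilon>" if n: "n \<ge> max N1 N2" for n
        using \<nu>[of n] eventually_I
      proof eventually_elim
        case (elim i)
        then have "vnorm (F i) (x n i \<ominus>\<^bsub>F i\<^esub> y i) < vdist L (\<sigma> n) (\<sigma> (\<nu> i)) + ?e (\<nu> i)"
          by (simp add: Q_def y_def)
        moreover have "vdist L (\<sigma> n) (\<sigma> (\<nu> i)) < \<epsilon>/2"
          using n elim by (intro N2) linarith+
        moreover have "?e (\<nu> i) \<le> ?e N1"
          using n elim by (intro le_imp_inverse_le) simp_all
        ultimately show ?case
          using N1 by linarith
      qed
      then show ?thesis by blast
    qed
    have y: "y \<in> CC"
    proof (rule co_cauchy_uniform_limit[OF yPi])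
      fix \<epsilon> :: real assume "\<epsilon> > 0"
      from near[OF this] x(1)
      show "\<exists>x\<in>CC. \<forall>\<^sub>F i in T. vnorm (F i) (x i \<ominus>\<^bsub>F i\<^esub> y i) < \<epsilon>"
        by blast
    qed
    have "limitin D.mtopology \<sigma> (cls y) sequentially"
      unfolding D.limit_metric_sequentially
    proof (intro conjI allI impI)
      show "cls y \<in> carrier L"
        by (rule cls_in_L[OF y])
      fix \<epsilon> :: real assume "\<epsilon> > 0"
      then have "\<epsilon>/2 > 0" by simp
      then obtain N where N: "\<forall>n\<ge>N. \<forall>\<^sub>F i in T. vnorm (F i) (x n i \<ominus>\<^bsub>F i\<^esub> y i) < \<epsilon>/2"
        using near by blast
      have "\<sigma> n \<in> carrier L \<and> vdist L (\<sigma> n) (cls y) < \<epsilon>" if "n \<ge> N" for n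
      proof -
        have "\<forall>\<^sub>F i in T. vnorm (F i) (x n i \<ominus>\<^bsub>F i\<^esub> y i) \<le> \<epsilon>/2"
          using spec[OF N, of n] that by (auto elim: eventually_mono)
        then have "vnorm L (cls (x n) \<ominus>\<^bsub>L\<^esub> cls y) \<le> \<epsilon>/2"
          by (rule vnorm_L_diff_le[OF x(1) y])
        then show ?thesis
          using \<open>\<epsilon> > 0\<close> by (simp add: x L.vdist_eq cls_in_L y)
      qed
      then show "\<exists>N. \<forall>n\<ge>N. \<sigma> n \<in> carrier L \<and> vdist L (\<sigma> n) (cls y) < \<epsilon>"
        by blast
    qed
    then show "\<exists>A. limitin D.mtopology \<sigma> A sequentially" by blast
  qed
qed

lemma cocone_L:
  assumes "E_property I leq"
  shows "cocone I leq F \<phi> L (L_map I leq F \<phi>)"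
  unfolding cocone_def
proof (intro conjI ballI impI)
  show "banach_vspace L"
    by (intro banach_vspace.intro banach_vspace_axioms.intro normed_vspace_L complete_L assms)
qed (rule linear_isometry_L_map L_map_compatible; assumption)+

section \<open>The universal property\<close>

lemma cocone_net_converges:
  assumes Z: "cocone I leq F \<phi> Z \<rho>" and x: "x \<in> CC"
  shows "\<exists>z. vlim Z (\<lambda>i. \<rho> i (x i)) z T"
proof -
  have \<rho>: "linear_isometry (F i) Z (\<rho> i)" if "i \<in> I" for i
    using Z that unfolding cocone_def by blast
  have comp: "\<rho> i a = \<rho> j (\<phi> i j a)" if "i \<in> I" "j \<in> I" "leq i j" "a \<in> carrier (F i)" for i j a
    using Z that unfolding cocone_def by blast
  interpret Z: banach_vspace Z
    using Z unfolding cocone_def by blast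
  show ?thesis
  proof (rule Z.Cauchy_net_converges[OF directed])
    show "\<rho> i (x i) \<in> carrier Z" if "i \<in> I" for i
      by (rule linear_isometryD(1)[OF \<rho>[OF that] co_cauchy_mem[OF x that]])
    fix \<epsilon> :: real assume "\<epsilon> > 0"
    obtain l where l: "l \<in> I"
      and s: "\<forall>i\<in>I. leq l i \<longrightarrow> (\<forall>j\<in>I. leq i j \<longrightarrow> vnorm (F j) (\<phi> i j (x i) \<ominus>\<^bsub>F j\<^esub> x j) < \<epsilon>)"
      using co_cauchy_small[OF x \<open>\<epsilon> > 0\<close>] unfolding eventually_T by blast
    have "vnorm Z (\<rho> l (x l) \<ominus>\<^bsub>Z\<^esub> \<rho> i (x i)) < \<epsilon>" if i: "i \<in> I" "leq l i" for i
    proof -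
      have "vnorm Z (\<rho> i (\<phi> l i (x l)) \<ominus>\<^bsub>Z\<^esub> \<rho> i (x i)) = vnorm (F i) (\<phi> l i (x l) \<ominus>\<^bsub>F i\<^esub> x i)"
        by (rule linear_isometry_vnorm_diff[OF \<rho>[OF i(1)] normed[OF i(1)] Z.normed_vspace_axioms
              \<phi>_closed[OF l i co_cauchy_mem[OF x l]] co_cauchy_mem[OF x i(1)]])
      moreover have "vnorm (F i) (\<phi> l i (x l) \<ominus>\<^bsub>F i\<^esub> x i) < \<epsilon>"
        using s l i index_refl[OF l] by blast
      ultimately show ?thesis
        using comp[OF l i co_cauchy_mem[OF x l]] by simp
    qed
    then show "\<exists>l\<in>I. \<forall>i\<in>I. leq l i \<longrightarrow> vnorm Z (\<rho> l (x l) \<ominus>\<^bsub>Z\<^esub> \<rho> i (x i)) < \<epsilon>"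
      using l by blast
  qed
qed

lemma cocone_limit_congruent:
  assumes Z: "cocone I leq F \<phi> Z \<rho>" and xy: "(x, y) \<in> R" and lim: "vlim Z (\<lambda>i. \<rho> i (x i)) z T"
  shows "vlim Z (\<lambda>i. \<rho> i (y i)) z T"
proof -
  have \<rho>: "linear_isometry (F i) Z (\<rho> i)" if "i \<in> I" for i
    using Z that unfolding cocone_def by blast
  interpret Z: banach_vspace Z
    using Z unfolding cocone_def by blast
  have m: "x \<in> CC" "y \<in> CC" and t: "((\<lambda>i. vnorm (F i) (x i \<ominus>\<^bsub>F i\<^esub> y i)) \<longlongrightarrow> 0) T"
    using xy by (simp_all add: null_rel_iff)
  show ?thesis
  proof (rule Z.vlim_near[OF lim])
    from eventually_I show "\<forall>\<^sub>F i in T. \<rho> i (y i) \<in> carrier Z"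
      by eventually_elim (rule linear_isometryD(1)[OF \<rho> co_cauchy_mem[OF m(2)]])
    show "((\<lambda>i. vnorm Z (\<rho> i (x i) \<ominus>\<^bsub>Z\<^esub> \<rho> i (y i))) \<longlongrightarrow> 0) T"
      using t by (subst tendsto_cong_I) (simp_all add: m co_cauchy_mem
        linear_isometry_vnorm_diff[OF \<rho> normed Z.normed_vspace_axioms])
  qed
qed

text \<open>By continuity a mediating isometry is determined by its values on the images of the canonical
  maps, hence by the cocone.\<close>

lemma mediating_map_vlim:
  assumes Z: "cocone I leq F \<phi> Z \<rho>" and f: "linear_isometry L Z f"
    and f\<rho>: "\<And>i a. i \<in> I \<Longrightarrow> a \<in> carrier (F i) \<Longrightarrow> f (L_map I leq F \<phi> i a) = \<rho> i a"
    and x: "x \<in> CC"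
  shows "vlim Z (\<lambda>i. \<rho> i (x i)) (f (cls x)) T"
proof -
  interpret Z: banach_vspace Z
    using Z unfolding cocone_def by blast
  from eventually_I have "\<forall>\<^sub>F i in T. f (L_map I leq F \<phi> i (x i)) = \<rho> i (x i)"
    by eventually_elim (simp add: f\<rho> co_cauchy_mem x)
  from Z.vlim_cong[OF this] show ?thesis
    using linear_isometry_vlim[OF f normed_vspace_L Z.normed_vspace_axioms L_map_vlim[OF x]] by blast
qed

text \<open>The map sending a class to the limit of the cocone along any representative is linear because
  limits are, and isometric because norms pass to limits on both sides.\<close>

lemma mediating_map_exists:
  assumes Z: "cocone I leq F \<phi> Z \<rho>"
  shows "\<exists>f\<in>extensional (carrier L). linear_isometry L Z f \<and>
    (\<forall>i\<in>I. \<forall>a\<in>carrier (F i). f (L_map I leq F \<phi> i a) = \<rho> i a)"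
proof -
  have \<rho>: "linear_isometry (F i) Z (\<rho> i)" if "i \<in> I" for i
    using Z that unfolding cocone_def by blast
  have comp: "\<rho> i a = \<rho> j (\<phi> i j a)" if "i \<in> I" "j \<in> I" "leq i j" "a \<in> carrier (F i)" for i j a
    using Z that unfolding cocone_def by blast
  interpret Z: banach_vspace Z
    using Z unfolding cocone_def by blast
  define f where "f = (\<lambda>A\<in>carrier L. THE z. \<forall>x\<in>A. vlim Z (\<lambda>i. \<rho> i (x i)) z T)"
  have f_eq: "f (cls x) = z" if x: "x \<in> CC" and z: "vlim Z (\<lambda>i. \<rho> i (x i)) z T" for x z
  proof -
    have "(THE z. \<forall>x\<in>cls x. vlim Z (\<lambda>i. \<rho> i (x i)) z T) = z"
    proof (rule the_equality)
      show "\<forall>y\<in>cls x. vlim Z (\<lambda>i. \<rho> i (y i)) z T"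
        using cocone_limit_congruent[OF Z _ z] by blast
      show "w = z" if "\<forall>y\<in>cls x. vlim Z (\<lambda>i. \<rho> i (y i)) w T" for w
        using Z.vlim_unique[OF _ z T_neq_bot] bspec[OF that equiv_class_self[OF equiv_null_rel x]]
        by blast
    qed
    then show ?thesis
      unfolding f_def by (simp add: cls_in_L x)
  qed
  have lim: "vlim Z (\<lambda>i. \<rho> i (x i)) (f (cls x)) T" if x: "x \<in> CC" for x
  proof -
    obtain z where z: "vlim Z (\<lambda>i. \<rho> i (x i)) z T"
      using cocone_net_converges[OF Z x] by blast
    then show ?thesis
      using f_eq[OF x z] by simp
  qed
  have "linear_isometry L Z f"
    unfolding linear_isometry_def
  proof (intro conjI ballI allI)
    show "f \<in> carrier L \<rightarrow> carrier Z"
    proof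
      fix A assume "A \<in> carrier L"
      then obtain x where "x \<in> CC" "A = cls x"
        by (rule L_cases)
      then show "f A \<in> carrier Z"
        using lim[of x] by (simp add: vlim_def)
    qed
    fix A assume "A \<in> carrier L"
    then obtain x where x: "x \<in> CC" "A = cls x"
      by (rule L_cases)
    show "f (c \<odot>\<^bsub>L\<^esub> A) = c \<odot>\<^bsub>Z\<^esub> f A" for c
      unfolding x(2) L_scale[OF x(1)]
    proof (rule f_eq[OF fam_scale_co_cauchy[OF x(1)]])
      from eventually_I have "\<forall>\<^sub>F i in T. \<rho> i (fam_scale c x i) = c \<odot>\<^bsub>Z\<^esub> \<rho> i (x i)"
        by eventually_elim (simp add: fam_apply linear_isometryD(3)[OF \<rho>] co_cauchy_mem x(1))
      from Z.vlim_cong[OF this] show "vlim Z (\<lambda>i. \<rho> i (fam_scale c x i)) (c \<odot>\<^bsub>Z\<^esub> f (cls x)) T"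
        using Z.vlim_scale[OF lim[OF x(1)]] by blast
    qed
    show "vnorm Z (f A) = vnorm L A"
      unfolding x(2)
    proof (rule vnorm_L_unique[OF x(1), symmetric])
      show "((\<lambda>i. vnorm (F i) (x i)) \<longlongrightarrow> vnorm Z (f (cls x))) T"
        using Z.vlim_vnorm[OF lim[OF x(1)]]
        by (subst tendsto_cong_I[of _ "\<lambda>i. vnorm Z (\<rho> i (x i))"])
          (simp_all add: linear_isometryD(4)[OF \<rho>] co_cauchy_mem x(1))
    qed
    fix B assume "B \<in> carrier L"
    then obtain y where y: "y \<in> CC" "B = cls y"
      by (rule L_cases)
    show "f (A \<oplus>\<^bsub>L\<^esub> B) = f A \<oplus>\<^bsub>Z\<^esub> f B"
      unfolding x(2) y(2) L_add[OF x(1) y(1)]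
    proof (rule f_eq[OF fam_add_co_cauchy[OF x(1) y(1)]])
      from eventually_I have "\<forall>\<^sub>F i in T. \<rho> i (fam_add x y i) = \<rho> i (x i) \<oplus>\<^bsub>Z\<^esub> \<rho> i (y i)"
        by eventually_elim (simp add: fam_apply linear_isometryD(2)[OF \<rho>] co_cauchy_mem x(1) y(1))
      from Z.vlim_cong[OF this]
      show "vlim Z (\<lambda>i. \<rho> i (fam_add x y i)) (f (cls x) \<oplus>\<^bsub>Z\<^esub> f (cls y)) T"
        using Z.vlim_add[OF lim[OF x(1)] lim[OF y(1)]] by blast
    qed
  qed
  moreover have "f (L_map I leq F \<phi> i a) = \<rho> i a" if i: "i \<in> I" and a: "a \<in> carrier (F i)" for i a
    unfolding L_map_eq
  proof (rule f_eq[OF fam_push_co_cauchy[OF i a]])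
    from eventually_above[OF i] have "\<forall>\<^sub>F j in T. \<rho> j (fam_push i a j) = \<rho> i a"
      by eventually_elim (simp add: fam_apply comp[OF i _ _ a, symmetric])
    from Z.vlim_cong[OF this] show "vlim Z (\<lambda>j. \<rho> j (fam_push i a j)) (\<rho> i a) T"
      using Z.vlim_const[OF linear_isometryD(1)[OF \<rho>[OF i] a]] by blast
  qed
  moreover have "f \<in> extensional (carrier L)"
    unfolding f_def by simp
  ultimately show ?thesis by blast
qed

lemma is_colimit_L:
  assumes "E_property I leq"
  shows "is_colimit TYPE('w) I leq F \<phi> L (L_map I leq F \<phi>)"
  unfolding is_colimit_def
proof (intro conjI allI impI cocone_L assms)
  fix Z :: "('k, 'w) normed_module" and \<rho>
  assume Z: "cocone I leq F \<phi> Z \<rho>"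
  interpret Z: banach_vspace Z
    using Z unfolding cocone_def by blast
  obtain f where f: "f \<in> extensional (carrier L)" "linear_isometry L Z f"
      "\<forall>i\<in>I. \<forall>a\<in>carrier (F i). f (L_map I leq F \<phi> i a) = \<rho> i a"
    using mediating_map_exists[OF Z] by blast
  show "\<exists>!f. f \<in> extensional (carrier L) \<and> linear_isometry L Z f \<and>
      (\<forall>i\<in>I. \<forall>a\<in>carrier (F i). f (L_map I leq F \<phi> i a) = \<rho> i a)"
  proof (rule ex1I[of _ f])
    show "f \<in> extensional (carrier L) \<and> linear_isometry L Z f \<and>
        (\<forall>i\<in>I. \<forall>a\<in>carrier (F i). f (L_map I leq F \<phi> i a) = \<rho> i a)"
      using f by blast
    fix g
    assume g: "g \<in> extensional (carrier L) \<and> linear_isometry L Z g \<and>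
        (\<forall>i\<in>I. \<forall>a\<in>carrier (F i). g (L_map I leq F \<phi> i a) = \<rho> i a)"
    show "g = f"
    proof (rule extensionalityI[of _ "carrier L"])
      fix A assume "A \<in> carrier L"
      then obtain x where x: "x \<in> CC" "A = cls x"
        by (rule L_cases)
      have "vlim Z (\<lambda>i. \<rho> i (x i)) (g (cls x)) T" "vlim Z (\<lambda>i. \<rho> i (x i)) (f (cls x)) T"
        using mediating_map_vlim[OF Z _ _ x(1)] f g by blast+
      then show "g A = f A"
        unfolding x(2) by (rule Z.vlim_unique[OF _ _ T_neq_bot])
    qed (use f g in blast)+
  qed
qed

end

theorem theoremA2:
  fixes I :: "'i set" and leq :: "'i \<Rightarrow> 'i \<Rightarrow> bool"
    and F :: "'i \<Rightarrow> ('k::real_normed_field, 'a) normed_module"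
    and \<phi> :: "'i \<Rightarrow> 'i \<Rightarrow> 'a \<Rightarrow> 'a"
    and C :: "('k, 'c) normed_module" and \<gamma> :: "'i \<Rightarrow> 'a \<Rightarrow> 'c"
  assumes "directed_preorder I leq"
    and "E_property I leq"
    and "codiagram I leq F \<phi>"
    and "is_colimit TYPE('w) I leq F \<phi> C \<gamma>"
  shows "is_colimit TYPE('w) I leq F \<phi> (L_space I leq F \<phi>) (L_map I leq F \<phi>)"
proof -
  interpret directed_codiagram I leq F \<phi>
    using assms(1,3) by (rule directed_codiagram.intro)
  show ?thesis
    by (rule is_colimit_L[OF assms(2)])
qed

end
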